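(* Let $f(z)=\sum_{n=0}^{\infty}a_nz^n$ be a power series with $a_n\ge 1$ for all $n\ge 0$. Suppose there are constants $c,C>0$ such that for every $r\in(0,1)$ and every $i\in\{0,1,2,3\}$, $$\frac{c}{(1-r)^{i+1}}\le f^{(i)}(r)\le \frac{C}{(1-r)^{i+1}}.$$ For integers $k\ge 1$ and $n$, let $a_{n,k}$ be the coefficient of $z^n$ in $f(z)^k$ (with $a_{n,k}=0$ for $n<0$). Then there exists a constant $A>1$, depending only on $c$ and $C$, such that for all sufficiently large $k$ (in terms of $c,C$) and all integers $0\le n\le A^{k^{1/3}}$, $$a_{n,k}^2\ge a_{n-1,k}\,a_{n+1,k}.$$
   Context: $f^{(i)}$ denotes the $i$-th derivative of $f$ (so $f^{(0)}=f$), and $f(z)^k$ denotes the $k$-th power of the series. *)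

theory Defs
  imports "HOL-Analysis.Analysis"
begin

text \<open>
  The coefficients are indexed by integers, so that the coefficient at \<open>n - 1\<close> for \<open>n = 0\<close>
  is \<open>0\<close> (natural-number subtraction would give the constant coefficient instead).
\<close>

definition pow_coeff :: "real fps \<Rightarrow> nat \<Rightarrow> int \<Rightarrow> real" where
  "pow_coeff f k n = (if n < 0 then 0 else fps_nth (f ^ k) (nat n))"

text \<open>
  The requirement on \<open>fps_conv_radius\<close> is implicit in writing \<open>f\<^sup>(\<^sup>i\<^sup>)(r)\<close> for all \<open>r\<close> in
  \<open>(0,1)\<close>; it has to be explicit because \<open>eval_fps\<close> and \<open>deriv\<close> are total functions.
\<close>

definition derivs_comparable :: "real \<Rightarrow> real \<Rightarrow> real fps \<Rightarrow> bool" where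
  "derivs_comparable c C f \<longleftrightarrow>
     fps_conv_radius f \<ge> 1 \<and>
     (\<forall>r\<in>{0<..<1}. \<forall>i\<in>{0,1,2,3::nat}.
        c / (1 - r) ^ (i + 1) \<le> (deriv ^^ i) (eval_fps f) r \<and>
        (deriv ^^ i) (eval_fps f) r \<le> C / (1 - r) ^ (i + 1))"

end

theory Submission
  imports Defs "HOL-Real_Asymp.Real_Asymp"
begin

text \<open>
  Write \<open>b\<^sub>m\<close> for the coefficients of \<open>f\<^sup>k\<close>. If \<open>n\<close> is bounded, the recurrence coming from
  \<open>f (f\<^sup>k)' = k f' f\<^sup>k\<close> gives \<open>b\<^sub>n / b\<^sub>n\<^sub>-\<^sub>1 = (1 + O(1/k)) k a\<^sub>1 / (n a\<^sub>0)\<close>, which decreases in \<open>n\<close> once \<open>k\<close> is large.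
  Otherwise choose \<open>r\<close> with \<open>r f'(r) / f(r) = \<mu> = n / k\<close>. By the arithmetic-geometric mean inequality it is
  enough that \<open>b\<^sub>m r\<^sup>m\<close> has a nonpositive second difference at \<open>m = n\<close>, that is,
  that the integral over \<open>[0, \<pi>]\<close> of \<open>(1 - cos x) Re ((e\<^sup>-\<^sup>i\<^sup>\<mu>\<^sup>x f(r e\<^sup>i\<^sup>x))\<^sup>k)\<close> is nonnegative.
  With \<open>N = k r\<close>, the integrand is nonnegative for \<open>x\<close> up to a small multiple of \<open>(1 - r) N\<^sup>-\<^sup>1\<^sup>/\<^sup>3\<close>: the choice of
  \<open>r\<close> removes the linear term of the phase, and the third moment controls the rest. The part up to
  \<open>(1 - r) N\<^sup>-\<^sup>1\<^sup>/\<^sup>2\<close> already contributes a multiple of \<open>f(r)\<^sup>k (1 - r)\<^sup>3 N\<^sup>-\<^sup>3\<^sup>/\<^sup>2\<close>. Beyond, \<open>a\<^sub>n \<ge> 1\<close> makes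
  \<open>f(r e\<^sup>i\<^sup>x)\<^sup>k\<close> smaller than \<open>f(r)\<^sup>k\<close> by a factor \<open>exp (- d N\<^sup>1\<^sup>/\<^sup>3)\<close>, which loses against
  \<open>(1 - r)\<^sup>3\<close> as long as \<open>n \<le> A\<close> to the power \<open>k\<^sup>1\<^sup>/\<^sup>3\<close>.
\<close>

subsection \<open>The initial coefficients of a power\<close>

lemma fps_power_nth_nonneg:
  fixes f :: "'a :: linordered_idom fps"
  assumes "\<And>j. fps_nth f j \<ge> 0"
  shows "fps_nth (f ^ k) j \<ge> 0"
  by (induction k arbitrary: j) (auto simp: fps_mult_nth assms intro!: sum_nonneg)

text \<open>Compare the coefficients of \<open>z^n\<close> in
  \<open>f * (z * (f^k)') = k * (z * f') * f^k\<close>; the extra factor \<open>z\<close> avoids any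
  index shift.\<close>

lemma fps_power_coeff_recurrence:
  fixes f :: "'a :: field_char_0 fps"
  shows "(\<Sum>j=0..n. fps_nth f j * (of_nat (n - j) * fps_nth (f ^ k) (n - j)))
       = of_nat k * (\<Sum>j=0..n. of_nat j * fps_nth f j * fps_nth (f ^ k) (n - j))"
proof -
  have X: "fps_nth (fps_X * fps_deriv g) m = of_nat m * fps_nth g m" for g :: "'a fps" and m
    by (cases m) (auto simp: fps_X_mult_nth)
  have "f * (fps_X * fps_deriv (f ^ k)) = of_nat k * ((fps_X * fps_deriv f) * f ^ k)"
    unfolding fps_deriv_power' by (cases k) (simp_all add: mult_ac del: of_nat_Suc)
  hence "fps_nth (f * (fps_X * fps_deriv (f ^ k))) n
       = fps_nth (of_nat k * ((fps_X * fps_deriv f) * f ^ k)) n"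
    by (rule arg_cong)
  also have "\<dots> = of_nat k * fps_nth ((fps_X * fps_deriv f) * f ^ k) n"
    by (simp only: fps_of_nat[symmetric] fps_mult_left_const_nth)
  finally show ?thesis unfolding fps_mult_nth[of f] fps_mult_nth[of "fps_X * fps_deriv f"] X .
qed

text \<open>For large \<open>k\<close> the term \<open>j = 1\<close> dominates the recurrence:
  \<open>m a_0 b_m\<close> lies between \<open>(k - m + 1) a_1 b_(m-1)\<close> and
  \<open>(k + D) a_1 b_(m-1)\<close>, with \<open>D\<close> independent of \<open>k\<close>. The
  claim follows by multiplying the lower bound at \<open>n\<close> with the upper bound at
  \<open>n + 1\<close>.\<close>

lemma log_concave_initial_coeffs:
  fixes f :: "real fps" and B :: real
  assumes ge1: "\<And>j. fps_nth f j \<ge> 1"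
    and bnd: "\<And>j. j \<le> n0 \<Longrightarrow> fps_nth f j \<le> B"
    and k1: "real k \<ge> 2 * real n0 * B + 2 * real n0"
    and k2: "real k \<ge> 2 * real n0 ^ 4 * B\<^sup>2 + (real n0)\<^sup>2"
    and n: "1 \<le> n" "n < n0"
  shows "fps_nth (f ^ k) (n - 1) * fps_nth (f ^ k) (n + 1) \<le> (fps_nth (f ^ k) n)\<^sup>2"
proof -
  define a where "a = fps_nth f"
  define b where "b = fps_nth (f ^ k)"
  define D where "D = 2 * real n0 ^ 3 * B\<^sup>2"
  have B1: "B \<ge> 1" using ge1[of 0] bnd[of 0] by simp
  have n0: "real n0 \<ge> 2" using n by simp
  have a1: "a j \<ge> 1" for j using ge1 by (simp add: a_def)
  have b0: "b j \<ge> 0" for j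
    unfolding b_def using ge1 by (intro fps_power_nth_nonneg) (auto intro: order_trans[OF zero_le_one])
  have rec: "real m * a 0 * b m = (\<Sum>j=1..m. (real k * j - (real m - j)) * a j * b (m - j))" for m
  proof -
    have "(\<Sum>j=0..m. a j * (real (m - j) * b (m - j))) = real k * (\<Sum>j=0..m. real j * a j * b (m - j))"
      using fps_power_coeff_recurrence[of f m k] by (simp add: a_def b_def)
    moreover have "(\<Sum>j=0..m. a j * (real (m - j) * b (m - j)))
        = a 0 * (m * b m) + (\<Sum>j=1..m. a j * (real (m - j) * b (m - j)))"
      by (simp add: sum.atLeast_Suc_atMost)
    moreover have "(\<Sum>j=0..m. real j * a j * b (m - j)) = (\<Sum>j=1..m. real j * a j * b (m - j))"
      by (simp add: sum.atLeast_Suc_atMost)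
    ultimately have "real m * a 0 * b m
        = real k * (\<Sum>j=1..m. real j * a j * b (m - j)) - (\<Sum>j=1..m. a j * (real (m - j) * b (m - j)))"
      by (simp add: algebra_simps)
    also have "\<dots> = (\<Sum>j=1..m. (real k * j - (real m - j)) * a j * b (m - j))"
      unfolding sum_distrib_left sum_subtractf[symmetric]
      by (intro sum.cong) (auto simp: of_nat_diff algebra_simps)
    finally show ?thesis .
  qed
  have nB: "real n0 * B \<ge> real n0" using B1 n0 by (simp add: mult_le_cancel_left1)
  have kn0: "real k \<ge> 4 * real n0" using nB k1 by linarith
  have kpos: "real k > 0" using kn0 n0 by linarith
  have split1: "real m * a 0 * b m = (real k - real m + 1) * a 1 * b (m - 1)
      + (\<Sum>j=2..m. (real k * j - (real m - j)) * a j * b (m - j))" if "m \<ge> 1" for m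
    using rec[of m] that by (simp add: sum.atLeast_Suc_atMost numeral_2_eq_2 algebra_simps)
  have lower: "(real k - real m + 1) * a 1 * b (m - 1) \<le> real m * a 0 * b m" if "1 \<le> m" "m \<le> n0" for m
  proof -
    have "(real k * j - (real m - j)) * a j * b (m - j) \<ge> 0" if j: "j \<in> {2..m}" for j
    proof -
      have "real k * j \<ge> real k * 1" using j kpos by (intro mult_left_mono) auto
      hence "real k * j - (real m - j) \<ge> 0" using kn0 \<open>m \<le> n0\<close> by linarith
      moreover have "a j \<ge> 0" using a1[of j] by linarith
      ultimately show ?thesis using b0 by simp
    qed
    hence "(\<Sum>j=2..m. (real k * j - (real m - j)) * a j * b (m - j)) \<ge> 0" by (rule sum_nonneg)
    thus ?thesis using split1[OF that(1)] by linarith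
  qed
  \<comment> \<open>A crude bound: each step up in the index gains a factor of order
    \<open>k\<close>. It serves to control the terms with \<open>j\<close> at least 2.\<close>
  have ratio: "real k * b (m - 1) \<le> 2 * real n0 * B * b m" if m: "1 \<le> m" "m \<le> n0" for m
  proof -
    have "(real k / 2) * 1 * b (m - 1) \<le> (real k - real m + 1) * a 1 * b (m - 1)"
      using kn0 m a1[of 1] kpos b0 by (intro mult_mono mult_right_mono) auto
    also have "\<dots> \<le> real m * a 0 * b m" by (rule lower[OF m])
    also have "\<dots> \<le> real n0 * B * b m"
      using m bnd[of 0] b0 a1[of 0] by (intro mult_right_mono mult_mono) (auto simp: a_def)
    finally show ?thesis by simp
  qed
  have mono1: "b (m - 1) \<le> b m" if m: "1 \<le> m" "m \<le> n0" for m
  proof -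
    have "real k * b (m - 1) \<le> 2 * real n0 * B * b m" by (rule ratio[OF m])
    also have "\<dots> \<le> real k * b m" using k1 n0 b0 by (intro mult_right_mono) auto
    finally show ?thesis using kpos by simp
  qed
  have mono: "b i \<le> b m" if "i \<le> m" "m \<le> n0" for i m
    using that
  proof (induction m)
    case (Suc m)
    show ?case
    proof (cases "i = Suc m")
      case False
      hence "b i \<le> b m" using Suc by auto
      also have "b m \<le> b (Suc m)" using mono1[of "Suc m"] Suc by auto
      finally show ?thesis .
    qed auto
  qed auto
  have upper: "real m * a 0 * b m \<le> (real k + D) * a 1 * b (m - 1)" if m: "1 \<le> m" "m \<le> n0" for m
  proof -
    \<comment> \<open>The factor \<open>k\<close> of the coefficient is absorbed by
      \<open>ratio\<close> at \<open>m - 1\<close>, so that the resulting bound is free of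
      \<open>k\<close>.\<close>
    have term_le: "(real k * j - (real m - j)) * a j * b (m - j) \<le> 2 * (real n0)\<^sup>2 * B\<^sup>2 * b (m - 1)"
      if j: "j \<in> {2..m}" for j
    proof -
      have "(real k * j - (real m - j)) * a j * b (m - j) \<le> (real k * n0) * B * b (m - 2)"
      proof (intro mult_mono)
        show "real k * j - (real m - j) \<le> real k * n0"
          using j m mult_left_mono[of "real j" "real n0" "real k"] by simp
        show "a j \<le> B" using bnd j m by (simp add: a_def)
        show "b (m - j) \<le> b (m - 2)" using j m by (intro mono) auto
        show "0 \<le> a j" using a1[of j] by linarith
      qed (use B1 b0 in auto)
      also have "\<dots> = real n0 * B * (real k * b (m - 2))" by simp
      also have "\<dots> \<le> real n0 * B * (2 * real n0 * B * b (m - 1))"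
        using ratio[of "m - 1"] j m B1 by (intro mult_left_mono) (auto simp: numeral_2_eq_2)
      finally show ?thesis by (simp add: power2_eq_square mult_ac)
    qed
    have "(\<Sum>j=2..m. (real k * j - (real m - j)) * a j * b (m - j))
        \<le> (\<Sum>j=2..m. 2 * (real n0)\<^sup>2 * B\<^sup>2 * b (m - 1))"
      by (rule sum_mono) (rule term_le)
    also have "\<dots> = real (m - 1) * (2 * (real n0)\<^sup>2 * B\<^sup>2 * b (m - 1))" using m by simp
    also have "\<dots> \<le> real n0 * (2 * (real n0)\<^sup>2 * B\<^sup>2 * b (m - 1))"
      using m b0 by (intro mult_right_mono) auto
    also have "\<dots> = D * b (m - 1)" by (simp add: D_def power2_eq_square power3_eq_cube)
    also have "\<dots> = D * 1 * b (m - 1)" by simp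
    also have "\<dots> \<le> D * a 1 * b (m - 1)"
      using a1[of 1] b0 by (intro mult_right_mono mult_left_mono) (auto simp: D_def)
    finally have tail: "(\<Sum>j=2..m. (real k * j - (real m - j)) * a j * b (m - j)) \<le> D * a 1 * b (m - 1)" .
    have "(real k - real m + 1) * a 1 * b (m - 1) \<le> real k * a 1 * b (m - 1)"
      using a1[of 1] b0 m by (intro mult_right_mono) auto
    with tail split1[OF m(1)] show ?thesis by (simp add: algebra_simps)
  qed
  have a01: "a 0 * a 1 > 0" using a1[of 0] a1[of 1] by simp
  have kn: "real k - real n + 1 > 0" using kn0 n by simp
  have D0: "D \<ge> 0" by (simp add: D_def)
  \<comment> \<open>The right side exceeds the left by \<open>k + 1 - D n - n^2\<close>; this is
    where \<open>k2\<close> enters.\<close>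
  have kD: "(real k + D) * real n \<le> (real n + 1) * (real k - real n + 1)"
  proof -
    have "D * real n \<le> D * real n0" using n D0 by (intro mult_left_mono) auto
    also have "\<dots> = 2 * real n0 ^ 4 * B\<^sup>2" by (simp add: D_def power_numeral_reduce)
    finally have "D * real n \<le> 2 * real n0 ^ 4 * B\<^sup>2" .
    moreover have "(real n)\<^sup>2 \<le> (real n0)\<^sup>2" using n by (intro power_mono) auto
    ultimately have "D * real n + (real n)\<^sup>2 \<le> real k" using k2 by linarith
    thus ?thesis by (simp add: algebra_simps power2_eq_square)
  qed
  have "(real n + 1) * a 0 * b (n + 1) \<le> (real k + D) * a 1 * b n"
    using upper[of "n + 1"] n by (simp add: add_ac)
  moreover have "(real k - real n + 1) * a 1 * b (n - 1) \<le> real n * a 0 * b n"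
    using lower[of n] n by simp
  moreover have "0 \<le> (real k + D) * a 1 * b n" "0 \<le> (real k - real n + 1) * a 1 * b (n - 1)"
    using b0 kn a1[of 1] D0 by auto
  ultimately have "((real n + 1) * a 0 * b (n + 1)) * ((real k - real n + 1) * a 1 * b (n - 1))
      \<le> ((real k + D) * a 1 * b n) * (real n * a 0 * b n)"
    by (rule mult_mono)
  hence "(a 0 * a 1) * ((real n + 1) * (real k - real n + 1) * (b (n - 1) * b (n + 1)))
      \<le> (a 0 * a 1) * ((real k + D) * real n * (b n)\<^sup>2)"
    by (simp add: power2_eq_square mult_ac)
  hence "(real n + 1) * (real k - real n + 1) * (b (n - 1) * b (n + 1)) \<le> (real k + D) * real n * (b n)\<^sup>2"
    using a01 by (simp only: mult_le_cancel_left_pos)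
  also have "\<dots> \<le> (real n + 1) * (real k - real n + 1) * (b n)\<^sup>2"
    by (intro mult_right_mono kD) auto
  finally have "b (n - 1) * b (n + 1) \<le> (b n)\<^sup>2"
    using kn by (simp add: mult_le_cancel_left_pos)
  thus ?thesis by (simp add: b_def)
qed

subsection \<open>Fourier integrals and elementary estimates\<close>

lemma has_integral_cos_int:
  "((\<lambda>x. cos (of_int j * x)) has_integral (if j = 0 then pi else 0)) {0..pi}"
proof (cases "j = 0")
  case True
  then show ?thesis using has_integral_const_real[of "1::real" 0 pi] by simp
next
  case False
  have "((\<lambda>x. cos (of_int j * x)) has_integral (sin (of_int j * pi) / of_int j - sin (of_int j * 0) / of_int j)) {0..pi}"
    using False
    by (intro fundamental_theorem_of_calculus)
       (auto intro!: derivative_eq_intros simp flip: has_real_derivative_iff_has_vector_derivative)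
  moreover have "sin (of_int j * pi) = 0" by (simp add: sin_times_pi_eq_0)
  ultimately show ?thesis using False by simp
qed

lemma has_integral_one_minus_cos_mult_cos:
  "((\<lambda>x. (1 - cos x) * cos (of_int j * x)) has_integral
     (if j = 0 then pi else if \<bar>j\<bar> = 1 then - pi / 2 else 0)) {0..pi}"
proof -
  have "((\<lambda>x. cos (of_int j * x) - 1/2 * (cos (of_int (j + 1) * x) + cos (of_int (j - 1) * x))) has_integral
     ((if j = 0 then pi else 0) - 1/2 * ((if j + 1 = 0 then pi else 0) + (if j - 1 = 0 then pi else 0)))) {0..pi}"
    by (intro has_integral_diff has_integral_add has_integral_mult_right has_integral_cos_int)
  moreover have "cos (of_int j * x) - 1/2 * (cos (of_int (j + 1) * x) + cos (of_int (j - 1) * x))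
      = (1 - cos x) * cos (of_int j * x)" for x :: real
    by (simp add: ring_distribs cos_add cos_diff)
  moreover have "(if j = 0 then pi else 0) - 1/2 * ((if j + 1 = 0 then pi else 0) + (if j - 1 = 0 then pi else 0))
      = (if j = 0 then pi else if \<bar>j\<bar> = 1 then - pi / 2 else 0)" by auto
  ultimately show ?thesis by simp
qed

text \<open>Uniform convergence permits termwise integration, and the kernel
  \<open>1 - cos x\<close> is orthogonal to all \<open>cos (j x)\<close> except \<open>j = 0\<close>
  and \<open>j = 1, -1\<close>. With \<open>n\<close> at least 1 all three surviving indices are
  natural numbers.\<close>

lemma has_integral_second_difference:
  fixes B :: "nat \<Rightarrow> real"
  assumes sm: "summable (\<lambda>m. \<bar>B m\<bar>)" and n: "n \<ge> 1"
  shows "((\<lambda>x. (1 - cos x) * (\<Sum>m. B m * cos ((real m - real n) * x))) has_integral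
          pi * (B n - (B (n - 1) + B (n + 1)) / 2)) {0..pi}"
proof -
  define g where "g = (\<lambda>m x. B m * ((1 - cos x) * cos (of_int (int m - int n) * x)))"
  define J where "J = (\<lambda>m. B m * (if int m - int n = 0 then pi else if \<bar>int m - int n\<bar> = 1 then - pi / 2 else 0))"
  have "uniform_limit {0..pi} (\<lambda>M x. \<Sum>m<M. g m x) (\<lambda>x. \<Sum>m. g m x) sequentially"
  proof (rule Weierstrass_m_test)
    show "summable (\<lambda>m. \<bar>B m\<bar> * 2)" using sm by (rule summable_mult2)
    fix m :: nat and x :: real
    have "\<bar>1 - cos x\<bar> * \<bar>cos (of_int (int m - int n) * x)\<bar> \<le> 2 * 1"
      using cos_ge_minus_one[of x] cos_le_one[of x] by (intro mult_mono) auto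
    thus "norm (g m x) \<le> \<bar>B m\<bar> * 2" by (auto simp: g_def abs_mult intro!: mult_left_mono)
  qed
  then obtain I L where I: "\<And>M. ((\<lambda>x. \<Sum>m<M. g m x) has_integral I M) {0..pi}"
    and L: "((\<lambda>x. \<Sum>m. g m x) has_integral L) {0..pi}" and lim: "I \<longlonglongrightarrow> L"
    by (rule uniform_limit_integral) (auto simp: g_def intro!: continuous_intros)
  have gJ: "(g m has_integral J m) {0..pi}" for m
    unfolding g_def J_def by (intro has_integral_mult_right has_integral_one_minus_cos_mult_cos)
  have "I M = (\<Sum>m<M. J m)" for M
    by (rule has_integral_unique[OF I]) (intro has_integral_sum gJ, auto)
  hence "J sums L" using lim unfolding sums_def by presburger
  moreover have "J sums (\<Sum>m\<in>{n-1, n, n+1}. J m)"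
    by (rule sums_finite) (use n in \<open>auto simp: J_def\<close>)
  moreover obtain p where "n = Suc p" using n by (cases n) auto
  hence "(\<Sum>m\<in>{n-1, n, n+1}. J m) = pi * (B n - (B (n - 1) + B (n + 1)) / 2)"
    by (simp add: J_def algebra_simps)
  ultimately have "L = pi * (B n - (B (n - 1) + B (n + 1)) / 2)" using sums_unique2 by metis
  moreover have "(\<Sum>m. g m x) = (1 - cos x) * (\<Sum>m. B m * cos ((real m - real n) * x))" for x
  proof -
    have "summable (\<lambda>m. B m * cos ((real m - real n) * x))"
      by (rule summable_comparison_test'[OF sm, of 0]) (auto simp: abs_mult mult_left_le)
    from suminf_mult[OF this, of "1 - cos x"] show ?thesis by (simp add: g_def mult_ac)
  qed
  ultimately show ?thesis using L by simp
qed

section \<open>Elementary bounds for sine, cosine and complex powers\<close>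

lemma cos_ge_one_minus_square: "1 - x\<^sup>2 / 2 \<le> cos (x::real)"
proof -
  have "cos x = 1 - 2 * (sin (x / 2))\<^sup>2" using cos_double_sin[of "x / 2"] by simp
  moreover have "(sin (x / 2))\<^sup>2 \<le> (x / 2)\<^sup>2" using abs_sin_x_le_abs_x[of "x/2"] by (simp flip: abs_le_square_iff)
  ultimately show ?thesis by (simp add: power_divide)
qed

lemma sin_minus_self_bound: "\<bar>sin x - x\<bar> \<le> \<bar>x\<bar> ^ 3 / 6" for x :: real
  using Maclaurin_sin_bound[of x 3] by (simp add: eval_nat_numeral sin_coeff_def)

lemma one_minus_cos_ge:
  assumes "0 \<le> x" "x \<le> pi"
  shows "x\<^sup>2 / 8 \<le> 1 - cos x"
proof -
  define y where "y = x / 2"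
  \<comment> \<open>The number 1.6 exceeds \<open>pi / 2\<close>, while its square stays below 3, so
    the cubic Taylor bound still gives \<open>sin y \<ge> y / 2\<close>.\<close>
  have y: "0 \<le> y" "y \<le> 1.6" using assms pi_approx by (auto simp: y_def)
  have "y\<^sup>2 \<le> 1.6\<^sup>2" using y by (intro power_mono)
  hence "y * (1/2 - y\<^sup>2 / 6) \<ge> 0" using y by (intro mult_nonneg_nonneg) (auto simp: power2_eq_square)
  hence "y / 2 \<le> y - y ^ 3 / 6" by (simp add: algebra_simps power2_eq_square power3_eq_cube)
  also have "\<dots> \<le> sin y" using sin_minus_self_bound[of y] y by (simp add: abs_if split: if_splits)
  finally have "(y / 2)\<^sup>2 \<le> (sin y)\<^sup>2" using y by (intro power_mono) auto
  moreover have "cos x = 1 - 2 * (sin y)\<^sup>2" using cos_double_sin[of y] by (simp add: y_def)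
  ultimately show ?thesis by (simp add: y_def power_divide)
qed

text \<open>This is the triangle inequality applied to the binomial expansion without its constant
  term.\<close>

lemma norm_one_plus_power_diff:
  fixes w :: "'a :: real_normed_field"
  shows "norm ((1 + w) ^ k - 1) \<le> (1 + norm w) ^ k - 1"
proof (induction k)
  case (Suc k)
  have "(1 + w) ^ Suc k - 1 = (1 + w) * ((1 + w) ^ k - 1) + w" by (simp add: algebra_simps)
  hence "norm ((1 + w) ^ Suc k - 1) \<le> norm (1 + w) * norm ((1 + w) ^ k - 1) + norm w"
    by (metis norm_mult norm_triangle_ineq)
  also have "\<dots> \<le> (1 + norm w) * ((1 + norm w) ^ k - 1) + norm w"
    using Suc norm_triangle_ineq[of 1 w] by (intro add_right_mono mult_mono) auto
  finally show ?case by (simp add: algebra_simps)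
qed auto

text \<open>Write \<open>z = Re z * (1 + i u)\<close> with \<open>k |u| \<le> 1/3\<close>. Then
  \<open>(1 + i u)^k\<close> differs from 1 by at most \<open>exp (1/3) - 1\<close>, which is below
  \<open>1/2\<close>.\<close>

lemma Re_power_ge:
  assumes re: "Re z > 0" and im: "real k * \<bar>Im z\<bar> \<le> Re z / 3"
  shows "Re (z ^ k) \<ge> Re z ^ k / 2"
proof -
  define u where "u = Im z / Re z"
  define w where "w = \<i> * of_real u"
  have z: "z = of_real (Re z) * (1 + w)"
    using re by (simp add: complex_eq_iff u_def w_def)
  have ku: "real k * \<bar>u\<bar> \<le> 1 / 3" using re im by (simp add: u_def field_simps)
  have "norm ((1 + w) ^ k - 1) \<le> (1 + \<bar>u\<bar>) ^ k - 1"
    using norm_one_plus_power_diff[of w k] by (simp add: w_def norm_mult)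
  also have "(1 + \<bar>u\<bar>) ^ k \<le> exp \<bar>u\<bar> ^ k" by (intro power_mono exp_ge_add_one_self) auto
  also have "\<dots> = exp (real k * \<bar>u\<bar>)" by (simp add: exp_of_nat_mult)
  also have "\<dots> \<le> exp (1 / 3)" using ku by simp
  also have "\<dots> \<le> 3 / 2" using exp_bound[of "1/3::real"] by (simp add: power2_eq_square)
  finally have "norm ((1 + w) ^ k - 1) \<le> 1 / 2" by simp
  hence "Re ((1 + w) ^ k) \<ge> 1 / 2" using abs_Re_le_cmod[of "(1 + w) ^ k - 1"] by simp
  moreover have "z ^ k = of_real (Re z ^ k) * (1 + w) ^ k" by (subst z) (simp add: power_mult_distrib)
  hence "Re (z ^ k) = Re z ^ k * Re ((1 + w) ^ k)" by simp
  moreover have "Re z ^ k > 0" using re by simp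
  ultimately show ?thesis by simp
qed

text \<open>
  The weights \<open>w\<close> are an unnormalised distribution with mean \<open>m\<close>; centring at the
  mean removes the linear term of the imaginary part.
\<close>
lemma centred_series_bounds:
  fixes w :: "nat \<Rightarrow> real"
  assumes w0: "\<And>n. w n \<ge> 0" and S: "w sums S"
    and mean: "(\<lambda>n. w n * (real n - m)) sums 0"
    and V: "(\<lambda>n. w n * (real n - m)\<^sup>2) sums V"
    and T: "(\<lambda>n. w n * \<bar>real n - m\<bar> ^ 3) sums T"
    and Z: "(\<lambda>n. of_real (w n) * cis ((real n - m) * x)) sums Z"
  shows "Re Z \<ge> S - V * x\<^sup>2 / 2" and "\<bar>Im Z\<bar> \<le> T * \<bar>x\<bar> ^ 3 / 6"
proof -
  have ReZ: "(\<lambda>n. w n * cos ((real n - m) * x)) sums Re Z"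
    using Z unfolding sums_complex_iff by simp
  have ImZ: "(\<lambda>n. w n * sin ((real n - m) * x)) sums Im Z"
    using Z unfolding sums_complex_iff by simp
  have W: "(\<lambda>n. w n - w n * (real n - m)\<^sup>2 * (x\<^sup>2 / 2)) sums (S - V * (x\<^sup>2 / 2))"
    by (intro sums_diff S sums_mult2 V)
  have "S - V * (x\<^sup>2 / 2) \<le> Re Z"
  proof (rule sums_le[OF _ W ReZ])
    fix n
    have "w n * (1 - ((real n - m) * x)\<^sup>2 / 2) \<le> w n * cos ((real n - m) * x)"
      by (intro mult_left_mono cos_ge_one_minus_square w0)
    moreover have "w n * (1 - ((real n - m) * x)\<^sup>2 / 2) = w n - w n * (real n - m)\<^sup>2 * (x\<^sup>2 / 2)"
      unfolding power_mult_distrib by (simp add: right_diff_distrib)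
    ultimately show "w n - w n * (real n - m)\<^sup>2 * (x\<^sup>2 / 2) \<le> w n * cos ((real n - m) * x)"
      by simp
  qed
  thus "Re Z \<ge> S - V * x\<^sup>2 / 2" by simp
  have Im: "(\<lambda>n. w n * sin ((real n - m) * x) - w n * (real n - m) * x) sums (Im Z - 0 * x)"
    by (intro sums_diff ImZ sums_mult2 mean)
  have T': "(\<lambda>n. w n * \<bar>real n - m\<bar> ^ 3 * (\<bar>x\<bar> ^ 3 / 6)) sums (T * (\<bar>x\<bar> ^ 3 / 6))"
    by (intro sums_mult2 T)
  have bd: "\<bar>w n * sin ((real n - m) * x) - w n * (real n - m) * x\<bar> \<le> w n * \<bar>real n - m\<bar> ^ 3 * (\<bar>x\<bar> ^ 3 / 6)" for n
  proof -
    have "w n * sin ((real n - m) * x) - w n * (real n - m) * x = w n * (sin ((real n - m) * x) - (real n - m) * x)"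
      by (simp add: algebra_simps)
    hence "\<bar>w n * sin ((real n - m) * x) - w n * (real n - m) * x\<bar> = w n * \<bar>sin ((real n - m) * x) - (real n - m) * x\<bar>"
      using w0[of n] by (simp add: abs_mult)
    also have "\<dots> \<le> w n * (\<bar>(real n - m) * x\<bar> ^ 3 / 6)"
      by (intro mult_left_mono sin_minus_self_bound w0)
    finally show ?thesis by (simp add: abs_mult power_mult_distrib mult_ac)
  qed
  have "Im Z - 0 * x \<le> T * (\<bar>x\<bar> ^ 3 / 6)"
    by (rule sums_le[OF abs_le_D1[OF bd] Im T'])
  moreover have "- (Im Z - 0 * x) \<le> T * (\<bar>x\<bar> ^ 3 / 6)"
    by (rule sums_le[OF abs_le_D2[OF bd] sums_minus[OF Im] T'])
  ultimately show "\<bar>Im Z\<bar> \<le> T * \<bar>x\<bar> ^ 3 / 6" by (auto simp: abs_le_iff)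
qed

text \<open>Compare \<open>G\<close> with the step function that is \<open>L\<close> on
  \<open>[u, v]\<close>, minus \<open>E\<close> on \<open>[s, p]\<close>, and 0 elsewhere. Here
  \<open>[0, s]\<close> plays the part of the major range and \<open>[s, p]\<close> that of the
  minor range.\<close>

lemma has_integral_ge_step:
  fixes G :: "real \<Rightarrow> real"
  assumes I: "(G has_integral I) {0..p}"
    and ord: "0 \<le> u" "u \<le> v" "v \<le> s" "s \<le> p" and "L \<ge> 0" "E \<ge> 0"
    and pos: "\<And>x. x \<in> {0..s} \<Longrightarrow> G x \<ge> 0"
    and low: "\<And>x. x \<in> {u..v} \<Longrightarrow> G x \<ge> L"
    and tail: "\<And>x. x \<in> {s..p} \<Longrightarrow> G x \<ge> - E"
  shows "I \<ge> L * (v - u) - E * p"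
proof -
  have "((\<lambda>x. if x \<in> {u..v} then L else 0) has_integral L * (v - u)) {0..p}"
    using ord has_integral_const_real[of L u v] by (subst has_integral_restrict) (auto simp: mult.commute)
  moreover have "((\<lambda>x. if x \<in> {s..p} then E else 0) has_integral E * (p - s)) {0..p}"
    using ord has_integral_const_real[of E s p] by (subst has_integral_restrict) (auto simp: mult.commute)
  ultimately have "((\<lambda>x. (if x \<in> {u..v} then L else 0) - (if x \<in> {s..p} then E else 0)) has_integral
      (L * (v - u) - E * (p - s))) {0..p}" by (rule has_integral_diff)
  hence "L * (v - u) - E * (p - s) \<le> I"
  proof (rule has_integral_le[OF _ I])
    fix x assume "x \<in> {0..p}"
    thus "(if x \<in> {u..v} then L else 0) - (if x \<in> {s..p} then E else 0) \<le> G x"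
      using pos[of x] low[of x] tail[of x] \<open>L \<ge> 0\<close> \<open>E \<ge> 0\<close> ord by auto
  qed
  moreover have "E * (p - s) \<le> E * p" using ord \<open>E \<ge> 0\<close> by (intro mult_left_mono) auto
  ultimately show ?thesis by linarith
qed

subsection \<open>Moments and the exponentially tilted series\<close>

lemma fps_conv_radius_higher_deriv:
  fixes f :: "'a :: {banach, real_normed_field} fps"
  shows "fps_conv_radius ((fps_deriv ^^ i) f) \<ge> fps_conv_radius f"
  by (induction i) (auto intro: order_trans[OF _ fps_conv_radius_deriv])

text \<open>This turns the hypothesis on analytic derivatives into one on formal derivatives. The
  induction needs equality near \<open>z\<close>, which holds because the disc of convergence is
  open.\<close>

lemma higher_deriv_eval_fps:
  fixes f :: "'a :: {banach, real_normed_field} fps"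
  assumes "norm z < fps_conv_radius f"
  shows "(deriv ^^ i) (eval_fps f) z = eval_fps ((fps_deriv ^^ i) f) z"
  using assms
proof (induction i arbitrary: z)
  case (Suc i)
  have z: "z \<in> eball 0 (fps_conv_radius f)" using Suc.prems by simp
  hence "eventually (\<lambda>w. w \<in> eball 0 (fps_conv_radius f)) (nhds z)"
    by (intro eventually_nhds_in_open) auto
  hence "eventually (\<lambda>w. (deriv ^^ i) (eval_fps f) w = eval_fps ((fps_deriv ^^ i) f) w) (nhds z)"
    by eventually_elim (auto intro: Suc.IH)
  hence "deriv ((deriv ^^ i) (eval_fps f)) z = deriv (eval_fps ((fps_deriv ^^ i) f)) z"
    by (intro deriv_cong_ev) auto
  also have "\<dots> = eval_fps (fps_deriv ((fps_deriv ^^ i) f)) z"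
    using Suc.prems fps_conv_radius_higher_deriv[of f i]
    by (intro eval_fps_deriv[symmetric]) (auto intro: less_le_trans)
  finally show ?case by simp
qed auto

text \<open>The factor \<open>X^i\<close> undoes the index shift of the derivative, so the series
  gives the factorial moments of the weights \<open>a_n z^n\<close>.\<close>

lemma sums_eval_fps_X_power_higher_deriv:
  fixes f :: "'a :: {banach, real_normed_field} fps"
  assumes "norm z < fps_conv_radius f"
  shows "(\<lambda>n. fps_nth (fps_X ^ i * (fps_deriv ^^ i) f) n * z ^ n) sums
           (z ^ i * eval_fps ((fps_deriv ^^ i) f) z)"
proof -
  have z: "norm z < fps_conv_radius ((fps_deriv ^^ i) f)"
    using assms fps_conv_radius_higher_deriv[of f i] by (rule less_le_trans)
  have "norm z < fps_conv_radius (fps_X ^ i * (fps_deriv ^^ i) f)"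
    using z by (intro less_le_trans[OF _ fps_conv_radius_mult]) auto
  from sums_eval_fps[OF this] show ?thesis using z by (simp add: eval_fps_mult)
qed

section \<open>Evaluation on circles in the complex plane\<close>

definition complex_fps :: "real fps \<Rightarrow> complex fps" where
  "complex_fps f = Abs_fps (\<lambda>n. complex_of_real (fps_nth f n))"

lemma complex_fps_nth [simp]: "fps_nth (complex_fps f) n = of_real (fps_nth f n)"
  by (simp add: complex_fps_def)

lemma complex_fps_power: "complex_fps (f ^ k) = complex_fps f ^ k"
proof (induction k)
  case (Suc k)
  have "complex_fps (f * f ^ k) = complex_fps f * complex_fps (f ^ k)"
    by (simp add: fps_eq_iff fps_mult_nth)
  with Suc show ?case by simp
qed (simp add: fps_eq_iff)

lemma fps_conv_radius_complex_fps [simp]: "fps_conv_radius (complex_fps f) = fps_conv_radius f"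
proof -
  have "Abs_fps (\<lambda>n. norm (fps_nth (complex_fps f) n)) = Abs_fps (\<lambda>n. norm (fps_nth f n))"
    by (simp add: fps_eq_iff)
  thus ?thesis
    by (metis fps_conv_radius_norm)
qed

text \<open>Up to normalisation this is the characteristic function, centred at \<open>m\<close>, of
  the distribution with weights \<open>a_n r^n\<close>.\<close>

definition rotated_eval :: "real fps \<Rightarrow> real \<Rightarrow> real \<Rightarrow> real \<Rightarrow> complex" where
  "rotated_eval f m r x = cis (- (m * x)) * eval_fps (complex_fps f) (of_real r * cis x)"

text \<open>Used twice: with \<open>k = 1\<close> for the moment estimates, and with
  \<open>k m = n\<close> for the Fourier integral of the coefficients of \<open>f^k\<close>.\<close>

lemma sums_rotated_eval_power:
  assumes "ereal \<bar>r\<bar> < fps_conv_radius f"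
  shows "(\<lambda>j. of_real (fps_nth (f ^ k) j * r ^ j) * cis ((real j - real k * m) * x)) sums
           rotated_eval f m r x ^ k"
proof -
  define z where "z = of_real r * cis x"
  have z: "norm z < fps_conv_radius (complex_fps f)" using assms by (simp add: z_def norm_mult)
  have "norm z < fps_conv_radius (complex_fps f ^ k)"
    using z fps_conv_radius_power[of "complex_fps f" k] by (rule less_le_trans)
  from sums_mult[OF sums_eval_fps[OF this], of "cis (- (m * x)) ^ k"]
  have "(\<lambda>j. cis (- (m * x)) ^ k * (fps_nth (complex_fps f ^ k) j * z ^ j)) sums
          (cis (- (m * x)) ^ k * eval_fps (complex_fps f ^ k) z)" .
  moreover have "cis (- (m * x)) ^ k * eval_fps (complex_fps f ^ k) z = rotated_eval f m r x ^ k"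
    using eval_fps_power[OF z] by (simp add: rotated_eval_def z_def power_mult_distrib)
  moreover have "cis (- (m * x)) ^ k * (fps_nth (complex_fps f ^ k) j * z ^ j)
      = of_real (fps_nth (f ^ k) j * r ^ j) * cis ((real j - real k * m) * x)" for j
  proof -
    have "cis (- (m * x)) ^ k * cis x ^ j = cis ((real j - real k * m) * x)"
      unfolding Complex.DeMoivre cis_mult by (rule arg_cong[of _ _ cis]) (simp add: algebra_simps)
    thus ?thesis
      by (simp add: z_def power_mult_distrib mult_ac flip: complex_fps_power)
  qed
  ultimately show ?thesis by simp
qed

section \<open>Consequences of the growth hypotheses: moments, saddle point, and decay off the
  axis\<close>

locale comparable_fps =
  fixes f :: "real fps" and c C :: real
  assumes c_pos: "c > 0" and ge1: "\<And>n. fps_nth f n \<ge> 1"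
    and comparable: "derivs_comparable c C f"
begin

definition F :: "nat \<Rightarrow> real \<Rightarrow> real" where
  "F i r = eval_fps ((fps_deriv ^^ i) f) r"

text \<open>The expectation of the distribution on the naturals proportional to
  \<open>a_n r^n\<close>; solving \<open>mean r = n / k\<close> is the saddle point
  equation.\<close>

definition mean :: "real \<Rightarrow> real" where
  "mean r = r * F 1 r / F 0 r"

lemma coeff_nonneg: "fps_nth f n \<ge> 0"
  using ge1[of n] by linarith

lemma in_conv_radius: "\<bar>r\<bar> < 1 \<Longrightarrow> ereal \<bar>r\<bar> < fps_conv_radius f"
  using comparable less_le_trans[of "ereal \<bar>r\<bar>" 1 "fps_conv_radius f"]
  by (simp add: derivs_comparable_def)

lemma F_bounds:
  assumes "0 < r" "r < 1" "i \<le> 3"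
  shows "c / (1 - r) ^ (i + 1) \<le> F i r" "F i r \<le> C / (1 - r) ^ (i + 1)"
proof -
  have "i \<in> {0, 1, 2, 3}" using assms by auto
  moreover have "(deriv ^^ i) (eval_fps f) r = F i r"
    unfolding F_def using assms in_conv_radius[of r] by (intro higher_deriv_eval_fps) auto
  moreover have "r \<in> {0<..<1}" using assms by simp
  ultimately show "c / (1 - r) ^ (i + 1) \<le> F i r" "F i r \<le> C / (1 - r) ^ (i + 1)"
    using comparable unfolding derivs_comparable_def by metis+
qed

lemma F0_pos: "0 < r \<Longrightarrow> r < 1 \<Longrightarrow> F 0 r > 0"
  using F_bounds(1)[of r 0] c_pos by (auto intro: less_le_trans[rotated])

lemma sums_falling:
  assumes "0 < r" "r < 1"
  shows "(\<lambda>n. fps_nth f n * r ^ n) sums F 0 r"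
    and "(\<lambda>n. fps_nth f n * r ^ n * real n) sums (r * F 1 r)"
    and "(\<lambda>n. fps_nth f n * r ^ n * (real n * (real n - 1))) sums (r\<^sup>2 * F 2 r)"
    and "(\<lambda>n. fps_nth f n * r ^ n * (real n * (real n - 1) * (real n - 2))) sums (r ^ 3 * F 3 r)"
proof -
  have r: "norm r < fps_conv_radius f" using assms in_conv_radius[of r] by simp
  note sm = sums_eval_fps_X_power_higher_deriv[OF r, folded F_def]
  show "(\<lambda>n. fps_nth f n * r ^ n) sums F 0 r" using sm[of 0] by simp
  have "fps_nth (fps_X ^ 1 * (fps_deriv ^^ 1) f) n * r ^ n = fps_nth f n * r ^ n * real n" for n
    by (cases n) (simp_all del: fps_deriv_nth add: fps_deriv_nth[of f])
  thus "(\<lambda>n. fps_nth f n * r ^ n * real n) sums (r * F 1 r)"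
    using sm[of 1] by (simp only: power_one_right)
  have "fps_nth (fps_X ^ 2 * (fps_deriv ^^ 2) f) n * r ^ n
      = fps_nth f n * r ^ n * (real n * (real n - 1))" for n
  proof (cases "n < 2")
    case True
    hence "n = 0 \<or> n = 1" by auto
    thus ?thesis by (auto simp: fps_X_power_mult_nth)
  next
    case False
    then obtain j where "n = j + 2" using le_Suc_ex[of 2 n] by auto
    moreover have "(fps_deriv ^^ 2) f = fps_deriv (fps_deriv f)" by (simp add: numeral_2_eq_2)
    ultimately show ?thesis by (simp add: fps_X_power_mult_nth)
  qed
  thus "(\<lambda>n. fps_nth f n * r ^ n * (real n * (real n - 1))) sums (r\<^sup>2 * F 2 r)"
    using sm[of 2] by (simp only:)
  have "fps_nth (fps_X ^ 3 * (fps_deriv ^^ 3) f) n * r ^ n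
      = fps_nth f n * r ^ n * (real n * (real n - 1) * (real n - 2))" for n
  proof (cases "n < 3")
    case True
    hence "n = 0 \<or> n = 1 \<or> n = 2" by auto
    thus ?thesis by (auto simp: fps_X_power_mult_nth)
  next
    case False
    then obtain j where "n = j + 3" using le_Suc_ex[of 3 n] by auto
    moreover have "(fps_deriv ^^ 3) f = fps_deriv (fps_deriv (fps_deriv f))"
      by (simp add: numeral_3_eq_3)
    ultimately show ?thesis by (simp add: fps_X_power_mult_nth eval_nat_numeral algebra_simps)
  qed
  thus "(\<lambda>n. fps_nth f n * r ^ n * (real n * (real n - 1) * (real n - 2))) sums (r ^ 3 * F 3 r)"
    using sm[of 3] by (simp only:)
qed

text \<open>At \<open>r = 1/2\<close> the series dominates the geometric series, whence
  \<open>2 \<le> f(1/2) \<le> 2 C\<close>.\<close>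

lemma C_ge_1: "C \<ge> 1"
proof -
  have G: "(\<lambda>n. (1/2) ^ n) sums (1 / (1 - 1/2 :: real))" by (rule geometric_sums) auto
  have "1 / (1 - 1/2 :: real) \<le> F 0 (1/2)"
    by (rule sums_le[OF _ G sums_falling(1)]) (use ge1 in auto)
  with F_bounds(2)[of "1/2" 0] show ?thesis by simp
qed

text \<open>Divide the upper bound for the \<open>i\<close>-th derivative by the lower bound for
  \<open>f\<close> itself. This controls the normalised factorial moments.\<close>

lemma ratio_bound:
  assumes "0 < r" "r < 1" "i \<le> 3"
  shows "F i r \<le> F 0 r * (C / c) / (1 - r) ^ i"
proof -
  have "F i r \<le> (c / (1 - r)) * (C / c) / (1 - r) ^ i"
    using F_bounds(2)[OF assms] c_pos by simp
  also have "\<dots> \<le> F 0 r * (C / c) / (1 - r) ^ i"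
    using F_bounds(1)[of r 0] assms c_pos C_ge_1
    by (intro divide_right_mono mult_right_mono) auto
  finally show ?thesis .
qed

lemma mean_bounds:
  assumes "0 < r" "r < 1"
  shows "mean r \<le> (C / c) * r / (1 - r)" "mean r \<ge> (c / C) * r / (1 - r)"
proof -
  have "r * F 1 r \<le> r * (F 0 r * (C / c) / (1 - r))"
    using ratio_bound[of r 1] assms by (intro mult_left_mono) auto
  thus "mean r \<le> (C / c) * r / (1 - r)"
    using F0_pos[OF assms] by (simp add: mean_def divide_le_eq mult_ac)
  have "(c / C) * F 0 r / (1 - r) \<le> (c / C) * (C / (1 - r)) / (1 - r)"
    using F_bounds(2)[of r 0] assms c_pos C_ge_1
    by (intro divide_right_mono mult_left_mono) auto
  also have "\<dots> = c / (1 - r) ^ 2" using C_ge_1 by (simp add: power2_eq_square)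
  also have "\<dots> \<le> F 1 r" using F_bounds(1)[of r 1] assms by (simp add: numeral_2_eq_2)
  finally have "r * ((c / C) * F 0 r / (1 - r)) \<le> r * F 1 r"
    using assms by (intro mult_left_mono) auto
  thus "mean r \<ge> (c / C) * r / (1 - r)"
    using F0_pos[OF assms] by (simp add: mean_def le_divide_eq mult_ac)
qed

text \<open>Intermediate values: \<open>mean\<close> vanishes at 0 and, by its lower bound, grows at
  least like \<open>(c / C) r / (1 - r)\<close> near 1.\<close>

lemma mean_surj:
  assumes "m > 0"
  obtains r where "0 < r" "r < 1" "mean r = m"
proof -
  \<comment> \<open>The first entry keeps \<open>b \<ge> 1/2\<close>; the second then makes the
    lower bound for \<open>mean b\<close> at least \<open>m + 1\<close>.\<close>
  define \<delta> where "\<delta> = min (1/2) (c / (2 * C * (m + 1)))"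
  define b where "b = 1 - \<delta>"
  have "\<delta> \<le> 1/2" unfolding \<delta>_def by (rule min.cobounded1)
  moreover have "0 < \<delta>" using c_pos C_ge_1 assms by (simp add: \<delta>_def)
  ultimately have d: "0 < \<delta>" "\<delta> \<le> 1/2" by auto
  have "\<delta> \<le> c / (2 * C * (m + 1))" by (simp add: \<delta>_def)
  moreover have "2 * C * (m + 1) > 0" using C_ge_1 assms by simp
  ultimately have "\<delta> * (2 * C * (m + 1)) \<le> c" by (simp only: pos_le_divide_eq)
  hence "(m + 1) * \<delta> * (2 * C) \<le> c" by (simp only: mult_ac)
  hence "(m + 1) * \<delta> \<le> c / (2 * C)" using C_ge_1 by (subst pos_le_divide_eq) auto
  hence "m + 1 \<le> c / (2 * C) / \<delta>" using d by (subst pos_le_divide_eq) auto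
  also have "\<dots> = (c / C) * (1/2) / \<delta>" by simp
  also have "\<dots> \<le> (c / C) * b / \<delta>"
    using d c_pos C_ge_1 by (intro divide_right_mono mult_left_mono) (auto simp: b_def)
  also have "\<dots> = (c / C) * b / (1 - b)" by (simp add: b_def)
  also have "\<dots> \<le> mean b" using mean_bounds(2)[of b] d by (simp add: b_def)
  finally have mb: "m \<le> mean b" by simp
  have cont: "continuous_on {0..b} (F i)" for i
  proof -
    have "continuous_on {0..b} (eval_fps ((fps_deriv ^^ i) f))"
    proof (rule continuous_on_subset[OF continuous_on_eval_fps], rule subsetI)
      fix x assume "x \<in> {0..b}"
      hence "\<bar>x\<bar> < 1" using d by (auto simp: b_def)
      thus "x \<in> eball 0 (fps_conv_radius ((fps_deriv ^^ i) f))"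
        using less_le_trans[OF in_conv_radius fps_conv_radius_higher_deriv] by simp
    qed
    thus ?thesis by (simp add: F_def[abs_def])
  qed
  have nz: "F 0 x \<noteq> 0" if x: "x \<in> {0..b}" for x
  proof (cases "x = 0")
    case True
    thus ?thesis using ge1[of 0] by (auto simp: F_def eval_fps_at_0)
  next
    case False
    thus ?thesis using F0_pos[of x] x d by (auto simp: b_def)
  qed
  have "continuous_on {0..b} (\<lambda>r. r * F 1 r / F 0 r)"
    by (intro continuous_on_divide continuous_on_mult continuous_on_id cont ballI nz)
  hence "continuous_on {0..b} mean" by (simp add: mean_def[abs_def])
  moreover have "mean 0 \<le> m" using assms by (simp add: mean_def)
  ultimately obtain r where r: "0 \<le> r" "r \<le> b" "mean r = m"
    using IVT'[of mean 0 m b] mb d by (auto simp: b_def)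
  have "r \<noteq> 0" using r assms by (auto simp: mean_def)
  with r d that[of r] show ?thesis by (auto simp: b_def)
qed

text \<open>The variance is \<open>E n(n-1) + E n - m^2\<close>, and the negative term is dropped.
  The factor \<open>r\<close> is kept in the bound because for small \<open>r\<close> the relevant
  large parameter is \<open>k r\<close> and not \<open>k\<close>.\<close>

lemma second_moment:
  assumes r: "0 < r" "r < 1"
  obtains V where "(\<lambda>n. fps_nth f n * r ^ n * (real n - mean r)\<^sup>2) sums V"
    and "V \<le> F 0 r * (2 * (C / c)) * r / (1 - r)\<^sup>2"
proof
  define m where "m = mean r"
  define Q where "Q = C / c"
  define t where "t = 1 - r"
  have t: "0 < t" "t \<le> 1" using r by (auto simp: t_def)
  have Q: "Q > 0" using c_pos C_ge_1 by (simp add: Q_def)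
  note F0 = F0_pos[OF r]
  have m: "r * F 1 r = m * F 0 r" using F0 by (simp add: m_def mean_def)
  have "(\<lambda>n. fps_nth f n * r ^ n * (real n * (real n - 1)) + fps_nth f n * r ^ n * real n
        - (fps_nth f n * r ^ n * real n) * (2 * m) + (fps_nth f n * r ^ n) * m\<^sup>2) sums
        (r\<^sup>2 * F 2 r + r * F 1 r - (r * F 1 r) * (2 * m) + F 0 r * m\<^sup>2)"
    by (intro sums_add sums_diff sums_mult2 sums_falling r)
  thus "(\<lambda>n. fps_nth f n * r ^ n * (real n - mean r)\<^sup>2) sums
        (r\<^sup>2 * F 2 r + r * F 1 r - (r * F 1 r) * (2 * m) + F 0 r * m\<^sup>2)"
    unfolding m_def[symmetric] by (simp add: power2_eq_square algebra_simps)
  have "r\<^sup>2 * F 2 r + r * F 1 r - (r * F 1 r) * (2 * m) + F 0 r * m\<^sup>2 = r\<^sup>2 * F 2 r + r * F 1 r - F 0 r * m\<^sup>2"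
    unfolding m by (simp add: power2_eq_square algebra_simps)
  also have "\<dots> \<le> r\<^sup>2 * F 2 r + r * F 1 r" using F0 by simp
  also have "\<dots> \<le> r * (F 0 r * Q / t\<^sup>2) + r * (F 0 r * Q / t\<^sup>2)"
  proof (intro add_mono mult_mono)
    show "r\<^sup>2 \<le> r" using r by (simp add: power2_eq_square mult_left_le)
    show F2: "F 2 r \<le> F 0 r * Q / t\<^sup>2" using ratio_bound[of r 2] r by (simp add: Q_def t_def)
    have "F 1 r \<le> F 0 r * Q / t" using ratio_bound[of r 1] r by (simp add: Q_def t_def)
    also have "\<dots> \<le> F 0 r * Q / t\<^sup>2"
      using t F0 Q by (intro divide_left_mono) (auto simp: power2_eq_square mult_left_le)
    finally show "F 1 r \<le> F 0 r * Q / t\<^sup>2" .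
    show "0 \<le> F 2 r" "0 \<le> F 1 r" using F_bounds(1)[of r 2] F_bounds(1)[of r 1] r c_pos
      by (auto intro: order_trans[rotated])
  qed (use r in auto)
  also have "\<dots> = F 0 r * (2 * Q) * r / t\<^sup>2" by simp
  finally show "r\<^sup>2 * F 2 r + r * F 1 r - (r * F 1 r) * (2 * m) + F 0 r * m\<^sup>2
      \<le> F 0 r * (2 * (C / c)) * r / (1 - r)\<^sup>2" unfolding Q_def t_def .
qed

text \<open>Since \<open>n\<close> and \<open>m\<close> are nonnegative,
  \<open>|n - m|^3 \<le> n^3 + m^3\<close>. Expanding
  \<open>n^3 = n(n-1)(n-2) + 3 n(n-1) + n\<close> yields the coefficient
  \<open>5 = 1 + 3 + 1\<close>; the cube of the mean yields \<open>(C / c)^3\<close>.\<close>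

lemma third_moment:
  assumes r: "0 < r" "r < 1"
  obtains T where "(\<lambda>n. fps_nth f n * r ^ n * \<bar>real n - mean r\<bar> ^ 3) sums T"
    and "T \<le> F 0 r * (5 * (C / c) + (C / c) ^ 3) * r / (1 - r) ^ 3"
proof -
  define m where "m = mean r"
  define Q where "Q = C / c"
  define t where "t = 1 - r"
  have t: "0 < t" "t \<le> 1" using r by (auto simp: t_def)
  have Q: "Q > 0" using c_pos C_ge_1 by (simp add: Q_def)
  note F0 = F0_pos[OF r]
  have F1: "F 1 r \<ge> 0" and F2: "F 2 r \<ge> 0" and F3: "F 3 r \<ge> 0"
    using F_bounds(1)[of r 1] F_bounds(1)[of r 2] F_bounds(1)[of r 3] r c_pos
    by (auto intro: order_trans[rotated])
  have m0: "m \<ge> 0" using F0 F1 r by (simp add: m_def mean_def)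
  have a0: "fps_nth f n * r ^ n \<ge> 0" for n using coeff_nonneg r by simp
  define g where "g = (\<lambda>n. fps_nth f n * r ^ n * (real n * (real n - 1) * (real n - 2))
        + fps_nth f n * r ^ n * (real n * (real n - 1)) * 3
        + fps_nth f n * r ^ n * real n + (fps_nth f n * r ^ n) * m ^ 3)"
  have g: "g sums (r ^ 3 * F 3 r + r\<^sup>2 * F 2 r * 3 + r * F 1 r + F 0 r * m ^ 3)"
    unfolding g_def by (intro sums_add sums_mult2 sums_falling r)
  have le: "fps_nth f n * r ^ n * \<bar>real n - m\<bar> ^ 3 \<le> g n" for n
  proof -
    have "\<bar>real n - m\<bar> ^ 3 \<le> max (real n) m ^ 3" using m0 by (intro power_mono) auto
    also have "\<dots> \<le> real n ^ 3 + m ^ 3" using m0 by (auto simp: max_def)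
    finally have "fps_nth f n * r ^ n * \<bar>real n - m\<bar> ^ 3 \<le> fps_nth f n * r ^ n * (real n ^ 3 + m ^ 3)"
      using a0 by (intro mult_left_mono) auto
    also have "\<dots> = g n" by (simp add: g_def power3_eq_cube algebra_simps)
    finally show ?thesis .
  qed
  have "summable (\<lambda>n. fps_nth f n * r ^ n * \<bar>real n - m\<bar> ^ 3)"
    by (rule summable_comparison_test'[OF sums_summable[OF g], of 0]) (use le coeff_nonneg r in \<open>auto simp: abs_mult\<close>)
  then obtain T where T: "(\<lambda>n. fps_nth f n * r ^ n * \<bar>real n - m\<bar> ^ 3) sums T"
    by (auto simp: summable_def)
  have pw: "F 0 r * Q / t ^ i \<le> F 0 r * Q / t ^ 3" if "i \<le> 3" for i
    using t F0 Q that by (intro divide_left_mono power_decreasing) auto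
  have rp: "r ^ Suc i \<le> r" for i using r by (simp add: mult_left_le power_le_one)
  have B: "F i r \<le> F 0 r * Q / t ^ 3" if "i \<le> 3" for i
    using ratio_bound[OF r that] pw[OF that] by (simp add: Q_def t_def)
  have "m \<le> Q * r / t" using mean_bounds(1)[OF r] by (simp add: m_def Q_def t_def)
  hence "m ^ 3 \<le> (Q * r / t) ^ 3" using m0 by (intro power_mono)
  also have "\<dots> = Q ^ 3 * r ^ 3 / t ^ 3" by (simp add: power_mult_distrib power_divide)
  also have "\<dots> \<le> Q ^ 3 * r / t ^ 3"
    using rp[of 2] Q t by (intro divide_right_mono mult_left_mono) auto
  finally have m3: "m ^ 3 \<le> Q ^ 3 * r / t ^ 3" .
  have "T \<le> r ^ 3 * F 3 r + r\<^sup>2 * F 2 r * 3 + r * F 1 r + F 0 r * m ^ 3"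
    by (rule sums_le[OF le T g])
  also have "\<dots> \<le> r * (F 0 r * Q / t ^ 3) + r * (F 0 r * Q / t ^ 3) * 3 + r * (F 0 r * Q / t ^ 3)
      + F 0 r * (Q ^ 3 * r / t ^ 3)"
  proof -
    have "r ^ 3 * F 3 r \<le> r * (F 0 r * Q / t ^ 3)"
      using rp[of 2] B[of 3] r F3 by (intro mult_mono) simp_all
    moreover have "r\<^sup>2 * F 2 r \<le> r * (F 0 r * Q / t ^ 3)"
      using rp[of 1] B[of 2] r F2 by (intro mult_mono) (simp_all add: power2_eq_square)
    moreover have "r * F 1 r \<le> r * (F 0 r * Q / t ^ 3)"
      using B[of 1] r by (intro mult_left_mono) simp_all
    moreover have "F 0 r * m ^ 3 \<le> F 0 r * (Q ^ 3 * r / t ^ 3)"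
      using m3 F0 by (intro mult_left_mono) simp_all
    ultimately show ?thesis by linarith
  qed
  also have "\<dots> = F 0 r * (5 * Q + Q ^ 3) * r / t ^ 3" using t by (simp add: field_simps)
  finally show ?thesis using that T unfolding Q_def t_def m_def by blast
qed

text \<open>
  Since \<open>a\<^sub>n \<ge> 1\<close>, the series \<open>f(z) - 1/(1 - z)\<close> has nonnegative coefficients, so all cancellation
  off the positive axis can be read off the geometric series.
\<close>
lemma norm_eval_le:
  assumes r: "0 < r" "r < 1"
  shows "norm (eval_fps (complex_fps f) (of_real r * cis x))
       \<le> F 0 r - (1 / (1 - r) - 1 / norm (1 - of_real r * cis x))"
proof -
  define z where "z = of_real r * cis x"
  have nz: "norm z = r" using r by (simp add: z_def norm_mult)
  have "norm z < fps_conv_radius (complex_fps f)" using in_conv_radius[of r] r nz by simp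
  from sums_eval_fps[OF this] have "(\<lambda>n. of_real (fps_nth f n) * z ^ n) sums eval_fps (complex_fps f) z" by simp
  moreover have "(\<lambda>n. z ^ n) sums (1 / (1 - z))" using nz r by (intro geometric_sums) auto
  ultimately have d: "(\<lambda>n. of_real (fps_nth f n) * z ^ n - z ^ n) sums (eval_fps (complex_fps f) z - 1 / (1 - z))"
    by (rule sums_diff)
  have d': "(\<lambda>n. fps_nth f n * r ^ n - r ^ n) sums (F 0 r - 1 / (1 - r))"
    using r by (intro sums_diff sums_falling geometric_sums) auto
  have "norm (of_real (fps_nth f n) * z ^ n - z ^ n) = fps_nth f n * r ^ n - r ^ n" for n
  proof -
    have "of_real (fps_nth f n) * z ^ n - z ^ n = of_real (fps_nth f n - 1) * z ^ n"
      by (simp add: algebra_simps)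
    also have "norm \<dots> = (fps_nth f n - 1) * r ^ n"
      using ge1[of n] nz by (simp only: norm_mult norm_power norm_of_real)
    finally show ?thesis by (simp add: algebra_simps)
  qed
  hence "norm (eval_fps (complex_fps f) z - 1 / (1 - z)) \<le> F 0 r - 1 / (1 - r)"
    using norm_sums_le[OF d d'] by simp
  moreover have "norm (eval_fps (complex_fps f) z) \<le> norm (eval_fps (complex_fps f) z - 1 / (1 - z)) + norm (1 / (1 - z))"
    by (metis diff_add_cancel norm_triangle_ineq)
  ultimately show ?thesis unfolding z_def by (simp add: norm_divide)
qed

text \<open>A single term of the series at \<open>r = 1/2\<close> is at most
  \<open>f(1/2) \<le> 2 C\<close>.\<close>

lemma coeff_le: "fps_nth f j \<le> 2 * C * 2 ^ j"
proof -
  have "(\<Sum>i\<in>{j}. fps_nth f i * (1/2) ^ i) \<le> (\<Sum>i. fps_nth f i * (1/2) ^ i)"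
    using sums_falling(1)[of "1/2"] coeff_nonneg
    by (intro sum_le_suminf) (auto simp: sums_iff)
  also have "\<dots> = F 0 (1/2)" using sums_falling(1)[of "1/2"] by (simp add: sums_iff)
  also have "\<dots> \<le> 2 * C" using F_bounds(2)[of "1/2" 0] by simp
  finally show ?thesis by (simp add: power_divide field_simps)
qed

text \<open>With \<open>t = 1 - r\<close>,
  \<open>|1 - r e^(ix)|^2 = t^2 + 2 r (1 - cos x) \<ge> t^2 (1 + u)\<close>. For
  \<open>u \<le> 3\<close> the root of \<open>1 + u\<close> is at least \<open>1 + u/3\<close>, and
  its reciprocal is at most \<open>1 - u/6\<close>. The loss \<open>u / (6 t)\<close> becomes a
  proportion of \<open>f(r)\<close> through \<open>f(r) \<le> C / t\<close>. The parameter
  \<open>y\<close> makes the bound uniform in \<open>x \<ge> y\<close>.\<close>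

lemma norm_rotated_eval_le:
  assumes r: "0 < r" "r < 1" and y: "0 \<le> y" "y \<le> x" and x: "x \<le> pi"
    and u: "u = r * y\<^sup>2 / (4 * (1 - r)\<^sup>2)" "u \<le> 3"
  shows "norm (rotated_eval f m r x) \<le> F 0 r * (1 - u / (6 * C))"
proof -
  define t where "t = 1 - r"
  define q where "q = norm (1 - of_real r * cis x)"
  have t: "t > 0" "t < 1" using r by (auto simp: t_def)
  have u0: "u \<ge> 0" using u r by simp
  have "q\<^sup>2 = (1 - r * cos x)\<^sup>2 + (r * sin x)\<^sup>2" by (simp add: q_def cmod_power2)
  also have "\<dots> = 1 - 2 * r * cos x + r\<^sup>2 * ((sin x)\<^sup>2 + (cos x)\<^sup>2)"
    by algebra
  also have "\<dots> = t\<^sup>2 + 2 * r * (1 - cos x)"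
    by (simp only: sin_cos_squared_add t_def power2_eq_square) (simp add: algebra_simps)
  finally have q2: "q\<^sup>2 = t\<^sup>2 + 2 * r * (1 - cos x)" .
  have "t\<^sup>2 * (1 + u / 3)\<^sup>2 \<le> t\<^sup>2 * (1 + u)"
  proof (intro mult_left_mono)
    have "u * u \<le> 3 * u" using u u0 by (intro mult_right_mono) auto
    thus "(1 + u / 3)\<^sup>2 \<le> 1 + u" by (simp add: power2_eq_square algebra_simps)
  qed auto
  also have "\<dots> = t\<^sup>2 + 2 * r * (y\<^sup>2 / 8)" using t u by (simp add: t_def field_simps)
  also have "\<dots> \<le> t\<^sup>2 + 2 * r * (1 - cos x)"
  proof -
    have "y\<^sup>2 \<le> x\<^sup>2" using y by (intro power_mono) auto
    hence "y\<^sup>2 / 8 \<le> 1 - cos x" using one_minus_cos_ge[of x] y x by linarith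
    thus ?thesis using r by (intro add_left_mono mult_left_mono) auto
  qed
  finally have "(t * (1 + u / 3))\<^sup>2 \<le> q\<^sup>2" by (simp add: q2 power_mult_distrib)
  hence tq: "t * (1 + u / 3) \<le> q" by (rule power2_le_imp_le) (simp add: q_def)
  have q0: "q > 0" using tq t u0 by (smt (verit) divide_nonneg_pos mult_pos_pos)
  have "t \<le> (1 - u / 6) * (t * (1 + u / 3))"
  proof -
    have "u * u \<le> 3 * u" using u u0 by (intro mult_right_mono) auto
    hence "1 \<le> (1 - u / 6) * (1 + u / 3)" by (simp add: algebra_simps)
    hence "t * 1 \<le> t * ((1 - u / 6) * (1 + u / 3))" using t by (intro mult_left_mono) auto
    thus ?thesis by (simp add: mult_ac)
  qed
  also have "\<dots> \<le> (1 - u / 6) * q" using tq u by (intro mult_left_mono) auto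
  finally have "1 / q \<le> (1 - u / 6) / t" using q0 t by (simp add: field_simps)
  hence "1 / t - 1 / q \<ge> u / (6 * t)" by (simp add: diff_divide_distrib)
  moreover have "u / (6 * t) \<ge> F 0 r * (u / (6 * C))"
  proof -
    have "F 0 r * (u / (6 * C)) \<le> (C / t) * (u / (6 * C))"
      using F_bounds(2)[of r 0] r u0 C_ge_1 by (intro mult_right_mono) (auto simp: t_def)
    thus ?thesis using C_ge_1 by (simp add: mult_ac)
  qed
  moreover have "norm (rotated_eval f m r x) \<le> F 0 r - (1 / t - 1 / q)"
    using norm_eval_le[OF r, of x] by (simp add: rotated_eval_def norm_mult t_def q_def)
  ultimately show ?thesis by (simp add: algebra_simps)
qed

lemma rotated_eval_major:
  assumes r: "0 < r" "r < 1"
  shows "Re (rotated_eval f (mean r) r x) \<ge> F 0 r * (1 - (C / c) * r * x\<^sup>2 / (1 - r)\<^sup>2)"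
    and "\<bar>Im (rotated_eval f (mean r) r x)\<bar>
           \<le> F 0 r * ((5 * (C / c) + (C / c) ^ 3) * r * \<bar>x\<bar> ^ 3 / (1 - r) ^ 3) / 6"
proof -
  obtain V where V: "(\<lambda>n. fps_nth f n * r ^ n * (real n - mean r)\<^sup>2) sums V"
    and Vle: "V \<le> F 0 r * (2 * (C / c)) * r / (1 - r)\<^sup>2" using second_moment[OF r] .
  obtain T where T: "(\<lambda>n. fps_nth f n * r ^ n * \<bar>real n - mean r\<bar> ^ 3) sums T"
    and Tle: "T \<le> F 0 r * (5 * (C / c) + (C / c) ^ 3) * r / (1 - r) ^ 3" using third_moment[OF r] .
  have Z: "(\<lambda>n. of_real (fps_nth f n * r ^ n) * cis ((real n - mean r) * x)) sums rotated_eval f (mean r) r x"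
    using sums_rotated_eval_power[OF in_conv_radius[of r], of 1 "mean r" x] r by simp
  have "(\<lambda>n. fps_nth f n * r ^ n * real n - fps_nth f n * r ^ n * mean r) sums (r * F 1 r - F 0 r * mean r)"
    by (intro sums_diff sums_mult2 sums_falling r)
  moreover have "r * F 1 r - F 0 r * mean r = 0" using F0_pos[OF r] by (simp add: mean_def)
  ultimately have M: "(\<lambda>n. fps_nth f n * r ^ n * (real n - mean r)) sums 0"
    by (simp add: algebra_simps)
  have w0: "fps_nth f n * r ^ n \<ge> 0" for n using coeff_nonneg r by simp
  note bounds = centred_series_bounds[OF w0 sums_falling(1)[OF r] M V T Z]
  have "V * x\<^sup>2 \<le> F 0 r * (2 * (C / c)) * r / (1 - r)\<^sup>2 * x\<^sup>2" using Vle by (rule mult_right_mono) auto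
  also have "\<dots> = 2 * (F 0 r * ((C / c) * r * x\<^sup>2 / (1 - r)\<^sup>2))" by simp
  finally have "V * x\<^sup>2 / 2 \<le> F 0 r * ((C / c) * r * x\<^sup>2 / (1 - r)\<^sup>2)" by linarith
  with bounds(1) show "Re (rotated_eval f (mean r) r x) \<ge> F 0 r * (1 - (C / c) * r * x\<^sup>2 / (1 - r)\<^sup>2)"
    unfolding right_diff_distrib by linarith
  have "T * \<bar>x\<bar> ^ 3 \<le> F 0 r * (5 * (C / c) + (C / c) ^ 3) * r / (1 - r) ^ 3 * \<bar>x\<bar> ^ 3"
    using Tle by (rule mult_right_mono) auto
  also have "\<dots> = F 0 r * ((5 * (C / c) + (C / c) ^ 3) * r * \<bar>x\<bar> ^ 3 / (1 - r) ^ 3)" by simp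
  finally have "T * \<bar>x\<bar> ^ 3 / 6 \<le> F 0 r * ((5 * (C / c) + (C / c) ^ 3) * r * \<bar>x\<bar> ^ 3 / (1 - r) ^ 3) / 6"
    by (rule divide_right_mono) simp
  with bounds(2) show "\<bar>Im (rotated_eval f (mean r) r x)\<bar>
           \<le> F 0 r * ((5 * (C / c) + (C / c) ^ 3) * r * \<bar>x\<bar> ^ 3 / (1 - r) ^ 3) / 6"
    by (rule order_trans)
qed

text \<open>
  With \<open>N = k r\<close>, the numbers \<open>p\<close> and \<open>s\<close> are the cube root and the square root of \<open>N\<close>: the phase of
  the \<open>k\<close>-th power stays bounded for \<open>x \<le> \<eta> (1 - r) / p\<close>, and its modulus is within a constant factor of
  its maximum for \<open>x \<le> \<eta> (1 - r) / s\<close>.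
\<close>
lemma log_concave_at_saddle:
  fixes \<eta> p s r :: real and k n :: nat
  assumes r: "0 < r" "r < 1" and n: "n \<ge> 1" and k: "k \<ge> 1"
    and saddle: "real k * mean r = real n"
    and p: "p ^ 3 = real k * r" "1 \<le> p" and s: "s\<^sup>2 = real k * r" "p \<le> s"
    and \<eta>: "0 < \<eta>" "\<eta> \<le> 1" "(C / c) * \<eta>\<^sup>2 \<le> 1 / 2" "(5 * (C / c) + (C / c) ^ 3) * \<eta> ^ 3 \<le> 1"
    and small: "512 * pi * exp (- (\<eta>\<^sup>2 / (24 * C)) * p) * s ^ 3 \<le> \<eta> ^ 3 * (1 - r) ^ 3"
  shows "fps_nth (f ^ k) (n - 1) * fps_nth (f ^ k) (n + 1) \<le> (fps_nth (f ^ k) n)\<^sup>2"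
proof -
  define Q where "Q = C / c"
  define t where "t = 1 - r"
  define S where "S = F 0 r"
  define Z where "Z = rotated_eval f (mean r) r"
  define B where "B = (\<lambda>m. fps_nth (f ^ k) m * r ^ m)"
  define \<theta>0 where "\<theta>0 = \<eta> * t / p"
  define \<theta>1 where "\<theta>1 = \<eta> * t / s"
  define \<epsilon> where "\<epsilon> = exp (- (\<eta>\<^sup>2 / (24 * C)) * p)"
  have t: "0 < t" "t < 1" using r by (auto simp: t_def)
  have S: "S > 0" using F0_pos[OF r] by (simp add: S_def)
  have Q: "Q > 0" using c_pos C_ge_1 by (simp add: Q_def)
  have p0: "p > 0" and s0: "s > 0" using p s by auto
  have kpos: "real k > 0" using k by simp
  have \<theta>1: "0 < \<theta>1" "\<theta>1 \<le> \<theta>0"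
    using \<eta> t p0 s0 s by (auto simp: \<theta>0_def \<theta>1_def intro!: divide_left_mono)
  have "\<eta> * t \<le> 1 * 1" using \<eta> t by (intro mult_mono) auto
  hence "\<theta>0 \<le> 1" using p by (simp add: \<theta>0_def divide_le_eq)
  hence \<theta>0: "\<theta>0 \<le> pi" using pi_gt3 by linarith
  have Re_lower: "Re (Z x) \<ge> S * (1 - Q * r * x\<^sup>2 / t\<^sup>2)" for x
    using rotated_eval_major(1)[OF r, of x] by (simp add: Z_def S_def Q_def t_def)
  have Im_upper: "\<bar>Im (Z x)\<bar> \<le> S * ((5 * Q + Q ^ 3) * r * \<bar>x\<bar> ^ 3 / t ^ 3) / 6" for x
    using rotated_eval_major(2)[OF r, of x] by (simp add: Z_def S_def Q_def t_def)
  \<comment> \<open>As \<open>p \<ge> 1\<close>, here \<open>x \<le> \<eta> t\<close>, so the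
    relative loss in the real part is at most \<open>Q \<eta>^2\<close>.\<close>
  have half: "Re (Z x) \<ge> S / 2" if x: "0 \<le> x" "x \<le> \<theta>0" for x
  proof -
    have "\<theta>0 \<le> \<eta> * t / 1"
      unfolding \<theta>0_def using p p0 \<eta> t by (intro divide_left_mono) auto
    hence "x \<le> \<eta> * t" using x by simp
    hence "x\<^sup>2 \<le> (\<eta> * t)\<^sup>2" using x by (intro power_mono) auto
    hence "Q * r * x\<^sup>2 \<le> Q * 1 * (\<eta> * t)\<^sup>2" using Q r by (intro mult_mono) auto
    also have "\<dots> = (Q * \<eta>\<^sup>2) * t\<^sup>2" by (simp add: power_mult_distrib)
    also have "\<dots> \<le> 1 / 2 * t\<^sup>2" using \<eta> by (intro mult_right_mono) (auto simp: Q_def)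
    finally have "Q * r * x\<^sup>2 / t\<^sup>2 \<le> 1 / 2" using t by (simp add: divide_le_eq)
    hence "S * (1 / 2) \<le> S * (1 - Q * r * x\<^sup>2 / t\<^sup>2)" using S by (intro mult_left_mono) auto
    with Re_lower[of x] show ?thesis by linarith
  qed
  \<comment> \<open>The cubic bound on the imaginary part, multiplied by \<open>k\<close>, stays
    bounded because \<open>p^3 = k r\<close> cancels \<open>k r\<close>.\<close>
  have arg: "real k * \<bar>Im (Z x)\<bar> \<le> Re (Z x) / 3" if x: "0 \<le> x" "x \<le> \<theta>0" for x
  proof -
    have "x ^ 3 \<le> \<theta>0 ^ 3" using x by (intro power_mono)
    hence "x ^ 3 \<le> \<eta> ^ 3 * t ^ 3 / (real k * r)"
      by (simp add: \<theta>0_def power_divide power_mult_distrib p)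
    hence "(5 * Q + Q ^ 3) * r * x ^ 3 \<le> (5 * Q + Q ^ 3) * r * (\<eta> ^ 3 * t ^ 3 / (real k * r))"
      using Q r by (intro mult_left_mono) auto
    also have "\<dots> = ((5 * Q + Q ^ 3) * \<eta> ^ 3) * (t ^ 3 / real k)" using r by simp
    also have "\<dots> \<le> 1 * (t ^ 3 / real k)"
      using \<eta> t by (intro mult_right_mono) (auto simp: Q_def)
    finally have "(5 * Q + Q ^ 3) * r * x ^ 3 / t ^ 3 \<le> 1 / real k" using t by (simp add: divide_le_eq)
    hence "S * ((5 * Q + Q ^ 3) * r * x ^ 3 / t ^ 3) / 6 \<le> S * (1 / real k) / 6"
      using S by (intro divide_right_mono mult_left_mono) auto
    with Im_upper[of x] x have "\<bar>Im (Z x)\<bar> \<le> S * (1 / real k) / 6" by simp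
    hence "real k * \<bar>Im (Z x)\<bar> \<le> S / 6" using kpos by (simp add: field_simps)
    also have "\<dots> \<le> Re (Z x) / 3" using half[OF x] by simp
    finally show ?thesis .
  qed
  have major: "Re (Z x ^ k) \<ge> Re (Z x) ^ k / 2" if x: "0 \<le> x" "x \<le> \<theta>0" for x
    using half[OF x] S by (intro Re_power_ge arg x) auto
  have major0: "Re (Z x ^ k) \<ge> 0" if x: "0 \<le> x" "x \<le> \<theta>0" for x
    using major[OF x] half[OF x] S by (smt (verit) zero_le_power divide_nonneg_pos)
  \<comment> \<open>Now \<open>s^2 = k r\<close> limits the relative loss to
    \<open>1 / (2 k)\<close>, and Bernoulli's inequality keeps half of the \<open>k\<close>-th
    power.\<close>
  have major1: "Re (Z x ^ k) \<ge> S ^ k / 4" if x: "0 \<le> x" "x \<le> \<theta>1" for x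
  proof -
    have "x\<^sup>2 \<le> \<theta>1\<^sup>2" using x by (intro power_mono)
    hence "x\<^sup>2 \<le> \<eta>\<^sup>2 * t\<^sup>2 / (real k * r)"
      by (simp add: \<theta>1_def power_divide power_mult_distrib s)
    hence "Q * r * x\<^sup>2 \<le> Q * r * (\<eta>\<^sup>2 * t\<^sup>2 / (real k * r))"
      using Q r by (intro mult_left_mono) auto
    also have "\<dots> = (Q * \<eta>\<^sup>2) * (t\<^sup>2 / real k)" using r by simp
    also have "\<dots> \<le> 1 / 2 * (t\<^sup>2 / real k)" using \<eta> t by (intro mult_right_mono) (auto simp: Q_def)
    finally have h: "Q * r * x\<^sup>2 / t\<^sup>2 \<le> 1 / (2 * real k)" using t by (simp add: divide_le_eq)
    have "S * (1 - 1 / (2 * real k)) \<le> S * (1 - Q * r * x\<^sup>2 / t\<^sup>2)" using S h by (intro mult_left_mono) auto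
    also have "\<dots> \<le> Re (Z x)" by (rule Re_lower)
    finally have ge: "S * (1 - 1 / (2 * real k)) \<le> Re (Z x)" .
    have "1 / (2 * real k) \<le> 1" using k by simp
    have "1 / 2 = 1 + real k * (- (1 / (2 * real k)))" using k by simp
    also have "\<dots> \<le> (1 + - (1 / (2 * real k))) ^ k"
      using \<open>1 / (2 * real k) \<le> 1\<close> by (intro Bernoulli_inequality) auto
    finally have "S ^ k * (1 / 2) \<le> S ^ k * (1 - 1 / (2 * real k)) ^ k"
      using S by (intro mult_left_mono) auto
    also have "\<dots> = (S * (1 - 1 / (2 * real k))) ^ k" by (simp add: power_mult_distrib)
    also have "\<dots> \<le> Re (Z x) ^ k"
      using ge S \<open>1 / (2 * real k) \<le> 1\<close> by (intro power_mono) auto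
    finally have "S ^ k / 2 \<le> Re (Z x) ^ k" by simp
    with major[of x] x \<theta>1 show ?thesis by linarith
  qed
  \<comment> \<open>Apply the off-axis bound with \<open>y = \<theta>0\<close>; then
    \<open>k u = \<eta>^2 p / 4\<close>, which gives the exponent in
    \<open>\<epsilon>\<close>.\<close>
  have minor: "norm (Z x ^ k) \<le> S ^ k * \<epsilon>" if x: "\<theta>0 \<le> x" "x \<le> pi" for x
  proof -
    define u where "u = r * \<theta>0\<^sup>2 / (4 * t\<^sup>2)"
    have u: "u = r * \<eta>\<^sup>2 / (4 * p\<^sup>2)"
      using t p0 by (simp add: u_def \<theta>0_def power_divide power_mult_distrib)
    have "r * \<eta>\<^sup>2 \<le> 1 * 1" using r \<eta> by (intro mult_mono) (auto simp: power_le_one)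
    moreover have "1 \<le> p\<^sup>2" using p by simp
    ultimately have u1: "u \<le> 1" using p0 by (simp add: u divide_le_eq)
    have ku: "real k * u = \<eta>\<^sup>2 / 4 * p"
    proof -
      have "real k * u = (real k * r) * \<eta>\<^sup>2 / (4 * p\<^sup>2)" by (simp add: u)
      also have "\<dots> = \<eta>\<^sup>2 / 4 * p"
        unfolding p(1)[symmetric] using p0 by (simp add: power2_eq_square power3_eq_cube)
      finally show ?thesis .
    qed
    have "norm (Z x) \<le> S * (1 - u / (6 * C))"
      unfolding Z_def S_def
      by (rule norm_rotated_eval_le[OF r _ x]) (use \<theta>1 u1 in \<open>auto simp: u_def t_def\<close>)
    also have "\<dots> \<le> S * exp (- (u / (6 * C)))"
      using exp_ge_add_one_self[of "- (u / (6 * C))"] S by (intro mult_left_mono) auto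
    finally have "norm (Z x) ^ k \<le> (S * exp (- (u / (6 * C)))) ^ k" by (intro power_mono) auto
    also have "\<dots> = S ^ k * exp (- (real k * u / (6 * C)))"
      by (simp add: power_mult_distrib flip: exp_of_nat_mult)
    also have "real k * u / (6 * C) = (\<eta>\<^sup>2 / (24 * C)) * p" unfolding ku by simp
    finally show ?thesis by (simp add: norm_power \<epsilon>_def)
  qed
  have rad: "ereal \<bar>r\<bar> < fps_conv_radius f" using in_conv_radius[of r] r by simp
  have "norm r < fps_conv_radius (f ^ k)"
    using rad fps_conv_radius_power[of f k] by (auto intro: less_le_trans)
  from norm_summable_fps[OF this] have sm: "summable (\<lambda>m. \<bar>B m\<bar>)" by (simp add: B_def)
  have ReZ: "(\<Sum>m. B m * cos ((real m - real n) * x)) = Re (Z x ^ k)" for x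
  proof -
    have "(\<lambda>m. Re (of_real (B m) * cis ((real m - real n) * x))) sums Re (Z x ^ k)"
      using sums_rotated_eval_power[OF rad, of k "mean r" x]
      by (intro sums_Re) (simp add: B_def Z_def saddle)
    thus ?thesis by (simp add: sums_iff)
  qed
  have I: "((\<lambda>x. (1 - cos x) * Re (Z x ^ k)) has_integral pi * (B n - (B (n - 1) + B (n + 1)) / 2)) {0..pi}"
    using has_integral_second_difference[OF sm n] unfolding ReZ .
  \<comment> \<open>The gain is taken on the upper half of \<open>[0, \<theta>1]\<close> only, since
    there \<open>1 - cos x\<close> is at least \<open>\<theta>1^2 / 32\<close>.\<close>
  have "S ^ k * \<theta>1\<^sup>2 / 128 * (\<theta>1 - \<theta>1 / 2) - 2 * (S ^ k * \<epsilon>) * pi \<le> pi * (B n - (B (n - 1) + B (n + 1)) / 2)"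
  proof (rule has_integral_ge_step[OF I, where s = \<theta>0])
    fix x assume x: "x \<in> {0..\<theta>0}"
    show "0 \<le> (1 - cos x) * Re (Z x ^ k)" using major0[of x] x by simp
  next
    fix x assume x: "x \<in> {\<theta>1 / 2..\<theta>1}"
    have "(\<theta>1 / 2)\<^sup>2 / 8 \<le> x\<^sup>2 / 8" using x \<theta>1 by (intro divide_right_mono power_mono) auto
    also have "\<dots> \<le> 1 - cos x" using x \<theta>1 \<theta>0 by (intro one_minus_cos_ge) auto
    finally have "(\<theta>1 / 2)\<^sup>2 / 8 * (S ^ k / 4) \<le> (1 - cos x) * Re (Z x ^ k)"
      using x \<theta>1 S by (intro mult_mono major1) auto
    thus "S ^ k * \<theta>1\<^sup>2 / 128 \<le> (1 - cos x) * Re (Z x ^ k)" by (simp add: power_divide mult_ac)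
  next
    fix x assume x: "x \<in> {\<theta>0..pi}"
    have "\<bar>(1 - cos x) * Re (Z x ^ k)\<bar> \<le> 2 * norm (Z x ^ k)"
      unfolding abs_mult using abs_Re_le_cmod[of "Z x ^ k"] cos_ge_minus_one[of x] cos_le_one[of x]
      by (intro mult_mono) auto
    also have "\<dots> \<le> 2 * (S ^ k * \<epsilon>)" using minor[of x] x by simp
    finally show "- (2 * (S ^ k * \<epsilon>)) \<le> (1 - cos x) * Re (Z x ^ k)" by linarith
  qed (use \<theta>1 \<theta>0 S in \<open>auto simp: \<epsilon>_def\<close>)
  moreover have "S ^ k * \<theta>1\<^sup>2 / 128 * (\<theta>1 - \<theta>1 / 2) - 2 * (S ^ k * \<epsilon>) * pi = S ^ k / 256 * (\<theta>1 ^ 3 - 512 * pi * \<epsilon>)"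
    by (simp add: power2_eq_square power3_eq_cube algebra_simps)
  moreover have "512 * pi * \<epsilon> \<le> \<theta>1 ^ 3"
    using small s0 by (simp add: \<theta>1_def \<epsilon>_def t_def power_divide power_mult_distrib le_divide_eq)
  hence "0 \<le> S ^ k / 256 * (\<theta>1 ^ 3 - 512 * pi * \<epsilon>)" using S by (intro mult_nonneg_nonneg) auto
  ultimately have "0 \<le> pi * (B n - (B (n - 1) + B (n + 1)) / 2)" by linarith
  hence mid: "(B (n - 1) + B (n + 1)) / 2 \<le> B n" 
    using pi_gt_zero unfolding zero_le_mult_iff by linarith
  have B0: "B j \<ge> 0" for j
    using r fps_power_nth_nonneg[OF coeff_nonneg] by (simp add: B_def)
  have "B (n - 1) * B (n + 1) \<le> ((B (n - 1) + B (n + 1)) / 2)\<^sup>2"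
  proof -
    have "0 \<le> (B (n - 1) - B (n + 1))\<^sup>2" by simp
    thus ?thesis by (simp add: power2_eq_square algebra_simps)
  qed
  also have "\<dots> \<le> (B n)\<^sup>2" using mid B0[of "n - 1"] B0[of "n + 1"] by (intro power_mono) auto
  finally have "B (n - 1) * B (n + 1) \<le> (B n)\<^sup>2" .
  \<comment> \<open>The powers of \<open>r\<close> on the two sides agree, so the tilt cancels from
    the inequality.\<close>
  moreover have "r ^ (n - 1) * r ^ (n + 1) = (r ^ n)\<^sup>2" using n by (cases n) (auto simp: power2_eq_square)
  moreover have "B (n - 1) * B (n + 1)
      = (fps_nth (f ^ k) (n - 1) * fps_nth (f ^ k) (n + 1)) * (r ^ (n - 1) * r ^ (n + 1))"
    by (simp only: B_def mult_ac)
  moreover have "(B n)\<^sup>2 = (fps_nth (f ^ k) n)\<^sup>2 * (r ^ n)\<^sup>2"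
    by (simp only: B_def power_mult_distrib)
  ultimately have "(fps_nth (f ^ k) (n - 1) * fps_nth (f ^ k) (n + 1)) * (r ^ n)\<^sup>2
      \<le> (fps_nth (f ^ k) n)\<^sup>2 * (r ^ n)\<^sup>2"
    by (simp only:)
  moreover have "(r ^ n)\<^sup>2 > 0" using r by simp
  ultimately show ?thesis by (rule mult_right_le_imp_le)
qed

end

text \<open>Exponential decay in \<open>N^(1/3)\<close> beats the factor
  \<open>s^3 = N^(3/2)\<close> lost in comparing the two ranges of integration.\<close>

lemma exp_decay_threshold:
  fixes d \<delta> :: real
  assumes "d > 0" "\<delta> > 0"
  obtains N0 where "N0 \<ge> 1" "\<And>N. N \<ge> N0 \<Longrightarrow> exp (- d * N powr (1/3)) * sqrt N ^ 3 \<le> \<delta>"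
proof -
  have "((\<lambda>N. exp (- d * N powr (1/3)) * sqrt N ^ 3) \<longlongrightarrow> 0) at_top"
    using assms(1) by real_asymp
  hence "eventually (\<lambda>N. exp (- d * N powr (1/3)) * sqrt N ^ 3 < \<delta>) at_top"
    using assms(2) by (rule order_tendstoD)
  then obtain M where M: "\<And>N. N \<ge> M \<Longrightarrow> exp (- d * N powr (1/3)) * sqrt N ^ 3 < \<delta>"
    by (auto simp: eventually_at_top_linorder)
  show ?thesis by (rule that[of "max 1 M"]) (simp, rule less_imp_le, rule M, simp)
qed

section \<open>Choice of the constants and the conclusion\<close>

theorem theorem1p2:
  fixes c C :: real
  assumes "c > 0" and "C > 0"
  shows "\<exists>A>1. \<exists>K::nat. \<forall>f :: real fps.
    (\<forall>n. fps_nth f n \<ge> 1) \<and> derivs_comparable c C f \<longrightarrow>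
    (\<forall>k::nat. k \<ge> 1 \<and> k \<ge> K \<longrightarrow>
      (\<forall>n::int. 0 \<le> n \<and> real_of_int n \<le> A powr (real k powr (1 / 3)) \<longrightarrow>
        (pow_coeff f k n)\<^sup>2 \<ge> pow_coeff f k (n - 1) * pow_coeff f k (n + 1)))"
proof -
  define Q where "Q = C / c"
  \<comment> \<open>\<open>W\<close> exceeds 1, \<open>2 Q\<close> and \<open>5 Q + Q^3\<close>, so
    \<open>1 / W\<close> meets all conditions on \<open>\<eta>\<close> at the saddle point.\<close>
  define W where "W = 1 + 7 * Q + Q ^ 3"
  define \<eta> where "\<eta> = 1 / W"
  define d where "d = \<eta>\<^sup>2 / (24 * C)"
  \<comment> \<open>The two entries of the minimum serve \<open>r < 1/2\<close>, where
    \<open>(1 - r)^3 \<ge> 1/8\<close>, and \<open>r \<ge> 1/2\<close>, where \<open>1 - r\<close>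
    is bounded below through \<open>n\<close>.\<close>
  define \<delta> where "\<delta> = \<eta> ^ 3 * min (1 / 8) ((1 / Q) ^ 3) / (512 * pi)"
  have Q: "Q > 0" using assms by (simp add: Q_def)
  have Q3: "Q ^ 3 > 0" using Q by simp
  have W: "W \<ge> 1" "W \<ge> 2 * Q" "W \<ge> 5 * Q + Q ^ 3" using Q Q3 unfolding W_def by linarith+
  hence \<eta>0: "0 < \<eta>" "\<eta> \<le> 1" by (auto simp: \<eta>_def)
  have d: "d > 0" using \<eta>0 assms by (simp add: d_def)
  have \<delta>: "\<delta> > 0" using \<eta>0 Q by (simp add: \<delta>_def)
  have \<eta>Q: "Q * \<eta>\<^sup>2 \<le> 1 / 2"
  proof -
    have "Q * \<eta>\<^sup>2 \<le> Q * \<eta>" using Q \<eta>0 by (intro mult_left_mono) (auto simp: power2_eq_square mult_left_le)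
    also have "\<dots> \<le> 1 / 2" using W by (simp add: \<eta>_def divide_le_eq)
    finally show ?thesis .
  qed
  have \<eta>M: "(5 * Q + Q ^ 3) * \<eta> ^ 3 \<le> 1"
  proof -
    have "\<eta> ^ 3 \<le> \<eta> ^ 1" using \<eta>0 by (intro power_decreasing) auto
    hence "(5 * Q + Q ^ 3) * \<eta> ^ 3 \<le> (5 * Q + Q ^ 3) * \<eta>" using Q Q3 by (intro mult_left_mono) auto
    also have "\<dots> \<le> 1" using W by (simp add: \<eta>_def)
    finally show ?thesis .
  qed
  obtain N0 where N0: "N0 \<ge> 1"
    and decay: "\<And>N. N \<ge> N0 \<Longrightarrow> exp (- (d / 2) * N powr (1/3)) * sqrt N ^ 3 \<le> \<delta>"
    using exp_decay_threshold[of "d / 2" \<delta>] d \<delta> by auto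
  \<comment> \<open>The recurrence handles \<open>n < n0\<close>; from \<open>n0\<close> on,
    \<open>n \<ge> 2 Q N0\<close>, which will force \<open>k r \<ge> N0\<close>. \<open>K\<close>
    collects the demands of both cases on \<open>k\<close>.\<close>
  define n0 where "n0 = nat \<lceil>2 * Q * N0\<rceil>"
  define B where "B = 2 * C * 2 ^ n0"
  define K where "K = nat \<lceil>max (2 * N0) (max (2 * real n0 * B + 2 * real n0) (2 * real n0 ^ 4 * B\<^sup>2 + (real n0)\<^sup>2))\<rceil>"
  \<comment> \<open>In the critical case \<open>k^(1/3) \<le> 2 p\<close>, so
    \<open>n \<le> exp (d p / 6)\<close>; the cube of this is exactly \<open>exp (d p / 2)\<close>,
    half of the available decay.\<close>
  define A where "A = exp (d / 12)"
  have goal: "fps_nth (f ^ k) (n - 1) * fps_nth (f ^ k) (n + 1) \<le> (fps_nth (f ^ k) n)\<^sup>2"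
    if f: "\<forall>n. fps_nth f n \<ge> 1" "derivs_comparable c C f" and k: "k \<ge> 1" "k \<ge> K"
      and n: "n \<ge> 1" "real n \<le> A powr (real k powr (1 / 3))" for f k n
  proof -
    interpret comparable_fps f c C using assms f by unfold_locales auto
    have "real k \<ge> real K" using k by simp
    hence kK: "real k \<ge> 2 * N0" "real k \<ge> 2 * real n0 * B + 2 * real n0"
      "real k \<ge> 2 * real n0 ^ 4 * B\<^sup>2 + (real n0)\<^sup>2"
      unfolding K_def by linarith+
    show ?thesis
    proof (cases "n < n0")
      case True
      have "fps_nth f j \<le> B" if "j \<le> n0" for j
      proof -
        have "2 * C * 2 ^ j \<le> B" unfolding B_def
          using assms that by (intro mult_left_mono power_increasing) auto
        with coeff_le[of j] show ?thesis by linarith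
      qed
      thus ?thesis using ge1 kK n True by (intro log_concave_initial_coeffs) auto
    next
      case False
      hence nN: "real n \<ge> 2 * Q * N0" unfolding n0_def by linarith
      have kpos: "real k > 0" using k by simp
      obtain r where r: "0 < r" "r < 1" and "mean r = real n / real k"
        using mean_surj[of "real n / real k"] n k by auto
      hence saddle: "real k * mean r = real n" using kpos by simp
      define N where "N = real k * r"
      define p where "p = N powr (1/3)"
      define s where "s = sqrt N"
      \<comment> \<open>The lower bound for the mean shows that \<open>1 - r\<close> is at least
        \<open>N / (Q n)\<close>, so a bound on \<open>n\<close> keeps \<open>r\<close> away from
        1.\<close>
      have "(c / C) * r \<le> mean r * (1 - r)"
        using mean_bounds(2)[OF r] r by (simp only: pos_divide_le_eq diff_gt_0_iff_gt)
      hence "(1 - r) * mean r \<ge> r / Q" by (simp add: Q_def mult_ac)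
      hence "real k * (r / Q) \<le> real k * ((1 - r) * mean r)" using kpos by (intro mult_left_mono) auto
      also have "\<dots> = (1 - r) * real n" using saddle by (simp add: mult_ac)
      finally have tn: "N / Q \<le> (1 - r) * real n" by (simp add: N_def)
      \<comment> \<open>For \<open>r \<ge> 1/2\<close> largeness of \<open>k\<close> suffices; for
        smaller \<open>r\<close> the mean is at most \<open>2 Q r\<close>, so
        \<open>n \<le> 2 Q N\<close> and largeness of \<open>n\<close> suffices.\<close>
      have NN0: "N \<ge> N0"
      proof (cases "r \<ge> 1 / 2")
        case True
        have "N \<ge> (2 * N0) * (1 / 2)" unfolding N_def using True kK N0 by (intro mult_mono) auto
        thus ?thesis by simp
      next
        case False
        have "mean r \<le> Q * r / (1 - r)" using mean_bounds(1)[OF r] by (simp add: Q_def)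
        also have "\<dots> \<le> Q * r / (1 / 2)" using False Q r by (intro divide_left_mono) auto
        finally have "real k * mean r \<le> real k * (2 * Q * r)" using kpos by (intro mult_left_mono) auto
        hence "2 * Q * N0 \<le> 2 * Q * N" using saddle nN by (simp add: N_def mult_ac)
        thus ?thesis using Q by simp
      qed
      have N1: "N \<ge> 1" using NN0 N0 by linarith
      have p3: "p ^ 3 = N" and p1: "p \<ge> 1" using N1
        by (simp_all add: p_def powr_power ge_one_powr_ge_zero)
      have s2: "s\<^sup>2 = N" using N1 by (simp add: s_def)
      have "p \<le> s" using N1 unfolding p_def s_def powr_half_sqrt[symmetric]
        by (subst powr_half_sqrt[symmetric]) (auto intro!: powr_mono)
      \<comment> \<open>One half of the decay absorbs \<open>s^3\<close>; the other half is saved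
        for the comparison with \<open>(1 - r)^3\<close>.\<close>
      have "exp (- d * p) = exp (- (d / 2) * p) * exp (- (d / 2) * p)"
        unfolding exp_add[symmetric] by simp
      hence "exp (- d * p) * s ^ 3 = exp (- (d / 2) * p) * (exp (- (d / 2) * p) * s ^ 3)"
        by simp
      also have "\<dots> \<le> exp (- (d / 2) * p) * \<delta>"
        using decay[OF NN0] by (intro mult_left_mono) (auto simp: p_def s_def)
      finally have "512 * pi * (exp (- d * p) * s ^ 3) \<le> 512 * pi * (exp (- (d / 2) * p) * \<delta>)"
        by (intro mult_left_mono) auto
      also have "\<dots> = \<eta> ^ 3 * (exp (- (d / 2) * p) * min (1 / 8) ((1 / Q) ^ 3))"
        by (simp add: \<delta>_def)
      also have "\<dots> \<le> \<eta> ^ 3 * (1 - r) ^ 3"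
      proof (intro mult_left_mono)
        show "exp (- (d / 2) * p) * min (1 / 8) ((1 / Q) ^ 3) \<le> (1 - r) ^ 3"
        proof (cases "r \<ge> 1 / 2")
          case False
          have "exp (- (d / 2) * p) * min (1 / 8) ((1 / Q) ^ 3) \<le> 1 * (1 / 8)"
            using d p1 Q by (intro mult_mono) auto
          also have "1 * (1 / 8) = (1 / 2 :: real) ^ 3" by (simp add: power3_eq_cube)
          also have "\<dots> \<le> (1 - r) ^ 3" using False by (intro power_mono) auto
          finally show ?thesis .
        next
          case True
          \<comment> \<open>In fact \<open>k \<le> 2 N\<close>; the constant is rounded up to a
            perfect cube.\<close>
          have "real k \<le> 8 * N"
            using mult_left_mono[OF True, of "real k"] kpos by (simp add: N_def)
          hence "real k powr (1 / 3) \<le> (8 * N) powr (1 / 3)" by (intro powr_mono2) auto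
          also have "\<dots> = 2 * p"
            using N1 powr_powr[of 2 3 "1/3"] by (simp add: powr_mult p_def)
          finally have k3: "real k powr (1 / 3) \<le> 2 * p" .
          have "real n \<le> exp (d / 12 * real k powr (1 / 3))"
            using n by (simp add: A_def powr_def mult_ac)
          also have "\<dots> \<le> exp (d / 12 * (2 * p))" using k3 d by simp
          finally have nexp: "real n \<le> exp (d / 6 * p)" by simp
          have "1 / Q \<le> N / Q" using N1 Q by (intro divide_right_mono) auto
          also note tn
          also have "(1 - r) * real n \<le> (1 - r) * exp (d / 6 * p)"
            using nexp r by (intro mult_left_mono) auto
          finally have "exp (- (d / 6 * p)) * (1 / Q) \<le> exp (- (d / 6 * p)) * ((1 - r) * exp (d / 6 * p))"
            by (intro mult_left_mono) auto
          also have "\<dots> = 1 - r" by (simp add: exp_minus)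
          finally have "(exp (- (d / 6 * p)) * (1 / Q)) ^ 3 \<le> (1 - r) ^ 3"
            using Q by (intro power_mono) auto
          moreover have "exp (- (d / 6 * p)) ^ 3 = exp (- (d / 2) * p)"
            by (simp flip: exp_of_nat_mult)
          ultimately have "exp (- (d / 2) * p) * (1 / Q) ^ 3 \<le> (1 - r) ^ 3"
            by (simp only: power_mult_distrib)
          moreover have "exp (- (d / 2) * p) * min (1 / 8) ((1 / Q) ^ 3) \<le> exp (- (d / 2) * p) * (1 / Q) ^ 3"
            by (intro mult_left_mono) auto
          ultimately show ?thesis by linarith
        qed
      qed (use \<eta>0 in auto)
      finally have "512 * pi * exp (- (\<eta>\<^sup>2 / (24 * C)) * p) * s ^ 3 \<le> \<eta> ^ 3 * (1 - r) ^ 3"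
        by (simp add: d_def mult_ac)
      with r n k saddle p3 p1 s2 \<open>p \<le> s\<close> \<eta>0 \<eta>Q \<eta>M show ?thesis
        by (intro log_concave_at_saddle[where \<eta> = \<eta> and p = p and s = s and r = r])
           (auto simp: N_def Q_def)
    qed
  qed
  have "A > 1" using d by (simp add: A_def)
  moreover have "pow_coeff f k (n - 1) * pow_coeff f k (n + 1) \<le> (pow_coeff f k n)\<^sup>2"
    if f: "\<forall>n. fps_nth f n \<ge> 1" "derivs_comparable c C f" and k: "k \<ge> 1" "k \<ge> K"
      and n: "0 \<le> n" "real_of_int n \<le> A powr (real k powr (1 / 3))" for f k n
  proof (cases "n = 0")
    \<comment> \<open>The coefficient at \<open>-1\<close> is 0 by convention, so the left side
      vanishes.\<close>
    case True
    thus ?thesis by (simp add: pow_coeff_def)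
  next
    case False
    then obtain m where m: "n = int m" "m \<ge> 1" using n by (cases n) auto
    have "nat (int m - 1) = m - 1" "nat (int m + 1) = m + 1" using m by auto
    thus ?thesis using goal[OF f k, of m] m n by (simp add: pow_coeff_def)
  qed
  ultimately show ?thesis by blast
qed

end
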